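(* Let $q$ be a prime power, let $M$ be a simple rank-$r$ matroid representable over $GF(q)$, and let $w$ be a weight function on $M$. Suppose $M\not\cong P_r$. Then $$\frac{w(M)}{g^\ast(M)}\geq \frac{q}{q-1}.$$ Moreover, equality holds if and only if, for a fixed embedding of $M$ as a restriction of $P_r$: (i) the complement of $M$ in $P_r$ (the restriction of $P_r$ to the points not in $E(M)$) is isomorphic to $P_k$, with $1\leq k<r$; (ii) if $P$ is a restriction of $P_r$ isomorphic to $P_{k+1}$ that contains the complement of $M$ in $P_r$, then $w$ is constant on $E(P)\cap E(M)$; and (iii) $w(N)\geq (q-1)\,w(E(M)-E(N))$ for every restriction $N$ of $M$ isomorphic to $A_r$.
   Context: $P_r$ denotes $PG(r-1,q)$ and $A_r$ denotes $AG(r-1,q)$. A weight function on a simple matroid $M$ is a function $w:E(M)\to\mathbb{Z}_{>0}$; for $X\subseteq E(M)$, $w(X)=\sum_{x\in X}w(x)$, $w(M)=w(E(M))$, and for a restriction $N$ of $M$, $w(N)=w(E(N))$. The cogirth $g^\ast(M)$ of a weighted matroid is the minimum weight of a cocircuit of $M$. *)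

theory Defs
  imports "HOL-Library.Function_Algebras" "HOL-Number_Theory.Prime_Powers"
begin

record 'a set_system =
  ground :: "'a set"
  indep :: "'a set \<Rightarrow> bool"

locale matroid =
  fixes M :: "'a set_system"
  assumes finite_ground: "finite (ground M)"
    and indep_subset_ground: "indep M X \<Longrightarrow> X \<subseteq> ground M"
    and indep_empty: "indep M {}"
    and indep_subset: "indep M Y \<Longrightarrow> X \<subseteq> Y \<Longrightarrow> indep M X"
    and augmentation:
      "indep M X \<Longrightarrow> indep M Y \<Longrightarrow> card X < card Y \<Longrightarrow> \<exists>y\<in>Y - X. indep M (insert y X)"

definition rank :: "'a set_system \<Rightarrow> nat" where
  "rank M = Max (card ` {X. indep M X})"

definition basis :: "'a set_system \<Rightarrow> 'a set \<Rightarrow> bool" where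
  "basis M B \<longleftrightarrow> indep M B \<and> (\<forall>X. indep M X \<longrightarrow> B \<subseteq> X \<longrightarrow> X = B)"

definition circuit :: "'a set_system \<Rightarrow> 'a set \<Rightarrow> bool" where
  "circuit M C \<longleftrightarrow> C \<subseteq> ground M \<and> \<not> indep M C \<and> (\<forall>X. X \<subset> C \<longrightarrow> indep M X)"

definition dual :: "'a set_system \<Rightarrow> 'a set_system" where
  "dual M = \<lparr>ground = ground M,
     indep = \<lambda>X. X \<subseteq> ground M \<and> (\<exists>B. basis M B \<and> B \<inter> X = {})\<rparr>"

definition cocircuit :: "'a set_system \<Rightarrow> 'a set \<Rightarrow> bool" where
  "cocircuit M C \<longleftrightarrow> circuit (dual M) C"

definition simple_matroid :: "'a set_system \<Rightarrow> bool" where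
  "simple_matroid M \<longleftrightarrow> matroid M \<and> (\<forall>C. circuit M C \<longrightarrow> 3 \<le> card C)"

definition restriction :: "'a set_system \<Rightarrow> 'a set \<Rightarrow> 'a set_system" where
  "restriction M X = \<lparr>ground = ground M \<inter> X, indep = \<lambda>Y. indep M Y \<and> Y \<subseteq> X\<rparr>"

definition matroid_iso :: "('a \<Rightarrow> 'b) \<Rightarrow> 'a set_system \<Rightarrow> 'b set_system \<Rightarrow> bool" where
  "matroid_iso f M N \<longleftrightarrow> bij_betw f (ground M) (ground N) \<and>
     (\<forall>X\<subseteq>ground M. indep M X \<longleftrightarrow> indep N (f ` X))"

definition isomorphic :: "'a set_system \<Rightarrow> 'b set_system \<Rightarrow> bool" where
  "isomorphic M N \<longleftrightarrow> (\<exists>f. matroid_iso f M N)"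

definition matroid_embedding :: "('a \<Rightarrow> 'b) \<Rightarrow> 'a set_system \<Rightarrow> 'b set_system \<Rightarrow> bool" where
  "matroid_embedding f M N \<longleftrightarrow> f ` ground M \<subseteq> ground N \<and>
     matroid_iso f M (restriction N (f ` ground M))"

definition weight_function :: "'a set_system \<Rightarrow> ('a \<Rightarrow> int) \<Rightarrow> bool" where
  "weight_function M w \<longleftrightarrow> (\<forall>x\<in>ground M. 0 < w x)"

definition cogirth :: "'a set_system \<Rightarrow> ('a \<Rightarrow> int) \<Rightarrow> int" where
  "cogirth M w = Min (sum w ` {C. cocircuit M C})"

definition fscale :: "'f::field \<Rightarrow> (nat \<Rightarrow> 'f) \<Rightarrow> nat \<Rightarrow> 'f" where
  "fscale c v = (\<lambda>i. c * v i)"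

global_interpretation fvs: vector_space "fscale :: 'f::field \<Rightarrow> (nat \<Rightarrow> 'f) \<Rightarrow> nat \<Rightarrow> 'f"
  by standard (simp_all add: fscale_def fun_eq_iff algebra_simps)

text \<open>The coordinate space of dimension \<open>n\<close>, inside the space of all sequences so that
  the dimension can be an ordinary natural number.\<close>

definition coord_space :: "'f::field itself \<Rightarrow> nat \<Rightarrow> (nat \<Rightarrow> 'f) set" where
  "coord_space F n = {v. \<forall>i\<ge>n. v i = 0}"

text \<open>\<open>f x\<close> is the column labelled by \<open>x\<close> of a representing matrix with \<open>n\<close> rows; injectivity
  is needed because equal columns with different labels are dependent.\<close>

definition representable :: "'f::field itself \<Rightarrow> 'a set_system \<Rightarrow> bool" where
  "representable F M \<longleftrightarrow> (\<exists>n f. f ` ground M \<subseteq> coord_space F n \<and>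
     (\<forall>X\<subseteq>ground M. indep M X \<longleftrightarrow> inj_on f X \<and> fvs.independent (f ` X)))"

definition proj_points :: "'f::field itself \<Rightarrow> nat \<Rightarrow> (nat \<Rightarrow> 'f) set set" where
  "proj_points F r = {fvs.span {v} |v. v \<in> coord_space F r \<and> v \<noteq> 0}"

text \<open>\<open>PG F r\<close> and \<open>AG F r\<close> are indexed by their rank \<open>r\<close>: they stand for \<open>PG(r-1,q)\<close> and
  \<open>AG(r-1,q)\<close>. Points are one-dimensional subspaces, and the rank of a set of
  points is the vector space dimension of the subspace that it spans.\<close>

definition PG :: "'f::field itself \<Rightarrow> nat \<Rightarrow> (nat \<Rightarrow> 'f) set set_system" where
  "PG F r = \<lparr>ground = proj_points F r,
     indep = \<lambda>X. X \<subseteq> proj_points F r \<and> fvs.dim (\<Union>X) = card X\<rparr>"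

text \<open>The deleted hyperplane is the one where the first coordinate vanishes; \<open>AG F r\<close> is only
  meaningful for \<open>r \<ge> 1\<close>.\<close>

definition AG :: "'f::field itself \<Rightarrow> nat \<Rightarrow> (nat \<Rightarrow> 'f) set set_system" where
  "AG F r = restriction (PG F r) {p \<in> proj_points F r. \<not> p \<subseteq> {v. v 0 = 0}}"

end

theory Submission
  imports Defs "HOL-Library.Cardinality"
begin

text \<open>Lift the weight to a function \<open>W\<close> on the vectors of \<open>GF(q)^r\<close> that vanishes on the vectors outside
  \<open>M\<close>; the cogirth is then the minimum weight off a hyperplane. Averaging over the hyperplanes
  that avoid a point outside \<open>M\<close> gives the inequality. If equality holds, all hyperplanes that avoid
  some missing point \<open>p\<close> carry the same weight, and since hyperplane sums determine a function,
  \<open>W\<close> is invariant under translation by \<open>p\<close>; hence the missing vectors form a subspace \<open>U\<close>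
  and \<open>W\<close> is constant on the cosets of \<open>U\<close>. Conversely, invariance under \<open>U\<close> makes
  every hyperplane not containing \<open>U\<close> carry exactly \<open>1/q\<close> of the weight, and condition (iii)
  handles the hyperplanes containing \<open>U\<close>.\<close>

section \<open>Coordinate spaces over a finite field\<close>

text \<open>The averaging gives the exact constant because, for a missing vector \<open>p\<close>,
  every vector outside the span of \<open>p\<close> is killed by precisely one \<open>q\<close>-th
  of the forms that do not kill \<open>p\<close>, while the span itself carries no weight. So the
  kernels of these forms hold on average exactly \<open>1/q\<close> of the weight, and some
  complement has weight at most \<open>(q-1)/q\<close> of the total. Under equality no complement
  can be lighter than this average, hence none is heavier. Vectors replace points because
  translation by \<open>p\<close> makes sense only there; each point then counts
  \<open>q - 1\<close> times. A further obstacle is that the conditions speak of restrictions that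
  are merely isomorphic to projective or affine geometries. That such a restriction is a subspace,
  or contains a hyperplane complement, is recovered from the sizes of lines: in the models they have
  \<open>q + 1\<close> and \<open>q\<close> points, and isomorphisms preserve these sizes. The
  counts are uniform in \<open>q\<close> and include \<open>q = 2\<close>, where an affine line is
  just a pair.\<close>

lemma card_field_ge_2: "2 \<le> CARD('f::{field,finite})"
proof -
  have "card {0, 1 :: 'f} \<le> CARD('f)"
    by (intro card_mono) auto
  then show ?thesis by simp
qed

lemma subspace_coord_space: "fvs.subspace (coord_space TYPE('f::field) n)"
  by (rule fvs.subspaceI) (auto simp: coord_space_def fscale_def)

lemma coord_space_Suc:
  "coord_space TYPE('f::field) (Suc n) = (\<lambda>(c, v). v(n := c)) ` (UNIV \<times> coord_space TYPE('f) n)"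
proof (intro equalityI subsetI)
  fix v assume v: "v \<in> coord_space TYPE('f) (Suc n)"
  then have "v(n := 0) \<in> coord_space TYPE('f) n"
    by (auto simp: coord_space_def Suc_le_eq)
  moreover have "v = (\<lambda>(c, v). v(n := c)) (v n, v(n := 0))" by simp
  ultimately show "v \<in> (\<lambda>(c, v). v(n := c)) ` (UNIV \<times> coord_space TYPE('f) n)"
    by blast
qed (auto simp: coord_space_def)

lemma finite_card_coord_space:
  "finite (coord_space TYPE('f::{field,finite}) n) \<and>
    card (coord_space TYPE('f) n) = CARD('f) ^ n"
proof (induction n)
  case 0
  have "coord_space TYPE('f) 0 = {0}"
    by (auto simp: coord_space_def fun_eq_iff)
  then show ?case by simp
next
  case (Suc n)
  have "inj_on (\<lambda>(c, v). v(n := c)) (UNIV \<times> coord_space TYPE('f) n)"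
  proof (rule inj_onI, clarify)
    fix c d :: 'f and u v
    assume uv: "u \<in> coord_space TYPE('f) n" "v \<in> coord_space TYPE('f) n"
      and eq: "u(n := c) = v(n := d)"
    have "c = d" using fun_cong[OF eq, of n] by simp
    moreover have "u i = v i" for i
      using uv fun_cong[OF eq, of i] by (cases "i = n") (auto simp: coord_space_def simp del: fun_upd_apply simp: fun_upd_def)
    ultimately show "c = d \<and> u = v" by auto
  qed
  then show ?case
    using Suc by (simp add: coord_space_Suc card_image card_cartesian_product)
qed

lemmas finite_coord_space = finite_card_coord_space[THEN conjunct1]
lemmas card_coord_space = finite_card_coord_space[THEN conjunct2]

text \<open>Sizes of spans, models of subspaces as projective geometries, and the transfer of a
  representation to \<open>r\<close> coordinates all come from this parametrisation by coefficients
  on a basis. \<open>T\<close> is linear on all sequences because it ignores the coordinates from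
  \<open>card B\<close> on.\<close>

lemma linear_iso_coord_space:
  fixes S :: "(nat \<Rightarrow> 'f::field) set"
  assumes "finite S"
  shows "\<exists>T. module_hom fscale fscale T \<and> inj_on T (coord_space TYPE('f) (fvs.dim S)) \<and>
    T ` coord_space TYPE('f) (fvs.dim S) = fvs.span S"
proof -
  obtain B where B: "B \<subseteq> S" "fvs.independent B" "S \<subseteq> fvs.span B" "card B = fvs.dim S"
    using fvs.basis_exists by blast
  have fin: "finite B" using B(1) assms finite_subset by blast
  obtain b where b: "bij_betw b {..<card B} B"
    using ex_bij_betw_nat_finite[OF fin] by (auto simp: atLeast0LessThan)
  define T where "T = (\<lambda>c. \<Sum>i<card B. fscale (c i) (b i))"
  have hom: "module_hom fscale fscale T"
    unfolding module_hom_iff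
  proof (intro conjI allI fvs.module_axioms)
    show "T (c + d) = T c + T d" for c d
      by (simp add: T_def fvs.scale_left_distrib sum.distrib)
    show "T (fscale k c) = fscale k (T c)" for k c
      by (simp add: T_def fvs.scale_sum_right) (simp add: fscale_def mult.assoc)
  qed
  have coeff: "T c = (\<Sum>v\<in>B. fscale (c (the_inv_into {..<card B} b v)) v)" for c
    unfolding T_def using b
    by (subst sum.reindex_bij_betw[OF b, symmetric], intro sum.cong)
      (auto simp: bij_betw_def the_inv_into_f_f)
  have inj: "inj_on T (coord_space TYPE('f) (card B))"
  proof -
    have "c = 0" if c: "c \<in> coord_space TYPE('f) (card B)" "T c = 0" for c
    proof
      fix i
      show "c i = 0 i"
      proof (cases "i < card B")
        case True
        then have "b i \<in> B" using b by (auto simp: bij_betw_def)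
        have "c (the_inv_into {..<card B} b (b i)) = 0"
          using c(2) by (intro fvs.independentD[OF B(2) fin subset_refl _ \<open>b i \<in> B\<close>]) (simp add: coeff)
        then show ?thesis using b True by (simp add: bij_betw_def the_inv_into_f_f)
      next
        case False
        then show ?thesis using c(1) by (simp add: coord_space_def)
      qed
    qed
    then show ?thesis
      using module_hom.inj_on_iff_eq_0[OF hom subspace_coord_space] by blast
  qed
  have "T ` coord_space TYPE('f) (card B) = fvs.span B"
  proof (intro equalityI subsetI)
    fix v assume "v \<in> fvs.span B"
    then obtain u where u: "v = (\<Sum>x\<in>B. fscale (u x) x)"
      using fvs.span_finite[OF fin] by auto
    define c where "c = (\<lambda>i. if i < card B then u (b i) else 0)"
    have "v = T c"
      unfolding u T_def
      using sum.reindex_bij_betw[OF b, of "\<lambda>x. fscale (u x) x"] by (auto simp: c_def intro!: sum.cong)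
    moreover have "c \<in> coord_space TYPE('f) (card B)"
      by (simp add: c_def coord_space_def)
    ultimately show "v \<in> T ` coord_space TYPE('f) (card B)" by blast
  next
    fix v assume "v \<in> T ` coord_space TYPE('f) (card B)"
    then obtain c where "v = (\<Sum>i<card B. fscale (c i) (b i))"
      by (auto simp: T_def)
    then show "v \<in> fvs.span B"
      using b by (auto simp: bij_betw_def intro!: fvs.span_sum fvs.span_scale intro: fvs.span_base)
  qed
  moreover have "fvs.span B = fvs.span S"
    using B(1,3) by (simp add: fvs.span_eq fvs.span_superset subset_trans)
  ultimately show ?thesis using hom inj B(4) by auto
qed

lemma card_span:
  fixes S :: "(nat \<Rightarrow> 'f::{field,finite}) set"
  assumes "finite S"
  shows "card (fvs.span S) = CARD('f) ^ fvs.dim S"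
  using linear_iso_coord_space[OF assms] by (metis card_coord_space card_image)

lemma finite_span:
  fixes S :: "(nat \<Rightarrow> 'f::{field,finite}) set"
  assumes "finite S"
  shows "finite (fvs.span S)"
  using linear_iso_coord_space[OF assms] by (metis finite_coord_space finite_imageI)

lemma card_subspace:
  fixes U :: "(nat \<Rightarrow> 'f::{field,finite}) set"
  assumes "finite U" "fvs.subspace U"
  shows "card U = CARD('f) ^ fvs.dim U"
  using card_span[OF assms(1)] assms(2) by (simp only: fvs.span_eq_iff[THEN iffD2])

lemma dim_coord_space: "fvs.dim (coord_space TYPE('f::{field,finite}) n) = n"
proof -
  have "CARD('f) ^ n = CARD('f) ^ fvs.dim (coord_space TYPE('f) n)"
    using card_subspace[OF finite_coord_space subspace_coord_space, of n]
    by (simp add: card_coord_space)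
  then show ?thesis
    using card_field_ge_2[where ?'f = 'f] by (simp add: power_inject_exp)
qed

text \<open>The ambient space of all sequences is infinite-dimensional, so dimensions are compared
  through the sizes of finite spans: \<open>q ^ d\<close> is strictly increasing in
  \<open>d\<close>.\<close>

lemma dim_mono:
  fixes A B :: "(nat \<Rightarrow> 'f::{field,finite}) set"
  assumes "finite B" "A \<subseteq> fvs.span B"
  shows "fvs.dim A \<le> fvs.dim B"
proof -
  have "finite A" using assms finite_span finite_subset by blast
  moreover have "fvs.span A \<subseteq> fvs.span B"
    using assms(2) by (simp add: fvs.span_minimal)
  ultimately have "CARD('f) ^ fvs.dim A \<le> CARD('f) ^ fvs.dim B"
    using assms(1) by (metis card_mono card_span finite_span)
  then show ?thesis
    using card_field_ge_2[where ?'f = 'f] by (simp add: power_le_imp_le_exp)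
qed

lemma subspace_eqI_dim:
  fixes A B :: "(nat \<Rightarrow> 'f::{field,finite}) set"
  assumes "finite B" "fvs.subspace A" "fvs.subspace B" "A \<subseteq> B" "fvs.dim B \<le> fvs.dim A"
  shows "A = B"
proof (rule card_subset_eq[OF assms(1,4)])
  have "fvs.dim A = fvs.dim B"
    using dim_mono[of B A] assms by (simp add: fvs.span_superset order_antisym subset_trans)
  then show "card A = card B"
    using assms finite_subset[OF assms(4,1)] by (simp add: card_subspace)
qed

lemma dim_linear_image:
  fixes S :: "(nat \<Rightarrow> 'f::{field,finite}) set"
  assumes "finite S" "module_hom fscale fscale T" "inj_on T (fvs.span S)"
  shows "fvs.dim (T ` S) = fvs.dim S"
proof -
  have "card (fvs.span (T ` S)) = card (fvs.span S)"
    by (simp add: module_hom.span_image[OF assms(2)] card_image assms(3))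
  then show ?thesis
    using assms(1) card_field_ge_2[where ?'f = 'f] by (simp add: card_span power_inject_exp)
qed

lemma independent_iff_dim:
  fixes S :: "(nat \<Rightarrow> 'f::field) set"
  assumes "finite S"
  shows "fvs.independent S \<longleftrightarrow> fvs.dim S = card S"
proof
  assume *: "fvs.dim S = card S"
  obtain B where "B \<subseteq> S" "fvs.independent B" "S \<subseteq> fvs.span B" "card B = fvs.dim S"
    using fvs.basis_exists by blast
  then show "fvs.independent S"
    using * card_subset_eq[OF assms] by metis
qed (rule fvs.dim_eq_card_independent)

lemma dim_insert_notin:
  fixes S :: "(nat \<Rightarrow> 'f::field) set"
  assumes "finite S" "v \<notin> fvs.span S"
  shows "fvs.dim (insert v S) = Suc (fvs.dim S)"
proof -
  obtain B where B: "B \<subseteq> S" "fvs.independent B" "S \<subseteq> fvs.span B" "card B = fvs.dim S"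
    using fvs.basis_exists by blast
  have eq: "fvs.span B = fvs.span S"
    using B(1,3) by (simp add: fvs.span_eq fvs.span_superset subset_trans)
  have "fvs.independent (insert v B)"
    using B(2) assms(2) eq by (simp add: fvs.independent_insertI)
  moreover have "v \<notin> B" using assms(2) eq fvs.span_base by blast
  moreover have "finite B" using B(1) assms(1) finite_subset by blast
  moreover have "fvs.span (insert v B) = fvs.span (insert v S)"
    using eq by (simp add: fvs.span_insert)
  ultimately show ?thesis
    using B(4) by (metis card_insert_disjoint fvs.dim_eq_card)
qed

section \<open>Linear forms\<close>

text \<open>Vectors \<open>a\<close> of the coordinate space stand for linear forms, and nonzero
  ones for hyperplanes. Each hyperplane is represented \<open>q - 1\<close> times, which is harmless
  in averages.\<close>

definition dot :: "nat \<Rightarrow> (nat \<Rightarrow> 'f::field) \<Rightarrow> (nat \<Rightarrow> 'f) \<Rightarrow> 'f" where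
  "dot r a v = (\<Sum>i<r. a i * v i)"

lemma dot_commute: "dot r a v = dot r v a"
  by (simp add: dot_def mult.commute)

lemma dot_add: "dot r a (u + v) = dot r a u + dot r a v" "dot r (a + b) v = dot r a v + dot r b v"
  by (simp_all add: dot_def algebra_simps sum.distrib)

lemma dot_diff: "dot r a (u - v) = dot r a u - dot r a v" "dot r (a - b) v = dot r a v - dot r b v"
  by (simp_all add: dot_def algebra_simps sum_subtractf)

lemma dot_scale: "dot r a (fscale c v) = c * dot r a v" "dot r (fscale c a) v = c * dot r a v"
  by (simp_all add: dot_def fscale_def sum_distrib_left algebra_simps)

lemma dot_zero [simp]: "dot r a 0 = 0" "dot r 0 v = 0"
  by (simp_all add: dot_def)

lemma coord_space_add: "u \<in> coord_space F n \<Longrightarrow> v \<in> coord_space F n \<Longrightarrow> u + v \<in> coord_space F n"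
  and coord_space_diff: "u \<in> coord_space F n \<Longrightarrow> v \<in> coord_space F n \<Longrightarrow> u - v \<in> coord_space F n"
  and coord_space_scale: "v \<in> coord_space F n \<Longrightarrow> fscale c v \<in> coord_space F n"
  and coord_space_zero: "0 \<in> coord_space F n"
  by (auto simp: coord_space_def fscale_def)

lemmas coord_space_closed = coord_space_add coord_space_diff coord_space_scale coord_space_zero

lemma subspace_dot_kernel: "fvs.subspace {v \<in> coord_space TYPE('f::field) r. dot r a v = 0}"
  by (rule fvs.subspaceI) (auto simp: coord_space_closed dot_add dot_scale)

lemma dot_eq_1:
  assumes "p \<in> coord_space TYPE('f::field) r" "p \<noteq> 0"
  shows "\<exists>b\<in>coord_space TYPE('f) r. dot r b p = 1"
proof -
  obtain i where i: "p i \<noteq> 0" using assms(2) by (auto simp: fun_eq_iff)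
  then have "i < r" using assms(1) by (intro ccontr[of "i < r"]) (simp add: coord_space_def)
  define b where "b = (\<lambda>j. if j = i then inverse (p i) else 0)"
  have "dot r b p = (\<Sum>j<r. if j = i then 1 else 0)"
    unfolding dot_def b_def by (rule sum.cong) (use i in auto)
  then have "dot r b p = 1" using \<open>i < r\<close> by simp
  moreover have "b \<in> coord_space TYPE('f) r"
    using \<open>i < r\<close> by (auto simp: b_def coord_space_def)
  ultimately show ?thesis by blast
qed

lemma dot_eq_1':
  assumes "a \<in> coord_space TYPE('f::field) r" "a \<noteq> 0"
  shows "\<exists>u\<in>coord_space TYPE('f) r. dot r a u = 1"
  using dot_eq_1[OF assms] by (metis dot_commute)

text \<open>Pigeonhole: the \<open>q ^ r\<close> linear forms have at most \<open>q ^ dim U\<close> restrictions to a basis of \<open>U\<close>.\<close>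

lemma ex_annihilator:
  fixes U :: "(nat \<Rightarrow> 'f::{field,finite}) set"
  assumes "finite U" "fvs.dim U < r"
  shows "\<exists>a\<in>coord_space TYPE('f) r. a \<noteq> 0 \<and> (\<forall>u\<in>U. dot r a u = 0)"
proof -
  obtain B where B: "B \<subseteq> U" "fvs.independent B" "U \<subseteq> fvs.span B" "card B = fvs.dim U"
    using fvs.basis_exists by blast
  have fin: "finite B" using B(1) assms(1) finite_subset by blast
  obtain b where b: "bij_betw b {..<card B} B"
    using ex_bij_betw_nat_finite[OF fin] by (auto simp: atLeast0LessThan)
  define h where "h = (\<lambda>a i. if i < card B then dot r a (b i) else 0)"
  have "h ` coord_space TYPE('f) r \<subseteq> coord_space TYPE('f) (card B)"
    by (auto simp: h_def coord_space_def)
  moreover have "card (coord_space TYPE('f) (card B)) < card (coord_space TYPE('f) r)"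
    using assms(2) B(4) card_field_ge_2[where ?'f = 'f] by (simp add: card_coord_space)
  ultimately have "\<not> inj_on h (coord_space TYPE('f) r)"
    by (meson card_inj_on_le finite_coord_space leD)
  then obtain x y where xy: "x \<in> coord_space TYPE('f) r" "y \<in> coord_space TYPE('f) r"
    "x \<noteq> y" "h x = h y"
    by (auto simp: inj_on_def)
  have "dot r (x - y) (b i) = 0" if "i < card B" for i
    using fun_cong[OF xy(4), of i] that by (simp add: h_def dot_diff)
  then have "dot r (x - y) v = 0" if "v \<in> B" for v
    using b that unfolding bij_betw_def by (metis imageE lessThan_iff)
  moreover have "fvs.subspace {v. dot r (x - y) v = 0}"
    by (rule fvs.subspaceI) (auto simp: dot_add dot_scale)
  ultimately have "fvs.span B \<subseteq> {v. dot r (x - y) v = 0}"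
    by (intro fvs.span_minimal) auto
  then show ?thesis
    using B(3) xy by (intro bexI[of _ "x - y"]) (auto simp: coord_space_closed)
qed

section \<open>Hyperplane sums\<close>

lemma sum_dot_fibres:
  fixes f :: "(nat \<Rightarrow> 'f::{field,finite}) \<Rightarrow> 'b::comm_monoid_add"
  shows "(\<Sum>v\<in>coord_space TYPE('f) r. f v) =
    (\<Sum>c\<in>UNIV. \<Sum>v | v \<in> coord_space TYPE('f) r \<and> dot r a v = c. f v)"
  by (rule sum.group[symmetric]) (simp_all add: finite_coord_space)

lemma sum_dot_fibre_translate:
  fixes f :: "(nat \<Rightarrow> 'f::{field,finite}) \<Rightarrow> 'b::comm_monoid_add"
  assumes "u \<in> coord_space TYPE('f) r"
  shows "(\<Sum>v | v \<in> coord_space TYPE('f) r \<and> dot r a v = c. f (v + u)) =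
    (\<Sum>v | v \<in> coord_space TYPE('f) r \<and> dot r a v = c + dot r a u. f v)"
  by (rule sum.reindex_bij_witness[where i = "\<lambda>v. v - u" and j = "\<lambda>v. v + u"])
    (use assms in \<open>auto simp: coord_space_closed dot_add dot_diff\<close>)

text \<open>The multiples of \<open>p\<close> meet every level of the form, so translating by a
  suitable multiple carries the kernel onto any level without changing \<open>f\<close>; all
  \<open>q\<close> level sums agree. It is applied to the constant \<open>1\<close> to count a
  kernel and to \<open>W\<close> in the converse direction.\<close>

lemma sum_eq_card_times_kernel_sum:
  fixes f :: "(nat \<Rightarrow> 'f::{field,finite}) \<Rightarrow> int"
  assumes p: "p \<in> coord_space TYPE('f) r" "dot r a p \<noteq> 0"
    and inv: "\<And>t v. v \<in> coord_space TYPE('f) r \<Longrightarrow> f (v + fscale t p) = f v"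
  shows "(\<Sum>v\<in>coord_space TYPE('f) r. f v) =
    int CARD('f) * (\<Sum>v | v \<in> coord_space TYPE('f) r \<and> dot r a v = 0. f v)"
proof -
  have fibre: "(\<Sum>v | v \<in> coord_space TYPE('f) r \<and> dot r a v = c. f v) =
    (\<Sum>v | v \<in> coord_space TYPE('f) r \<and> dot r a v = 0. f v)" (is "_ = ?K") for c
  proof -
    let ?u = "fscale (c / dot r a p) p"
    have "?K = (\<Sum>v | v \<in> coord_space TYPE('f) r \<and> dot r a v = 0. f (v + ?u))"
      by (rule sum.cong) (auto simp: inv)
    also have "\<dots> = (\<Sum>v | v \<in> coord_space TYPE('f) r \<and> dot r a v = c. f v)"
      using p by (subst sum_dot_fibre_translate) (auto simp: coord_space_closed dot_scale)
    finally show ?thesis by simp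
  qed
  show ?thesis
    unfolding sum_dot_fibres[of f r a] by (rule trans[OF sum.cong[OF refl fibre]]) simp
qed

text \<open>Stated as a product, so that neither a division nor the exponent \<open>r - 1\<close>
  appears.\<close>

lemma card_dot_kernel:
  fixes a :: "nat \<Rightarrow> 'f::{field,finite}"
  assumes "a \<in> coord_space TYPE('f) r" "a \<noteq> 0"
  shows "CARD('f) * card {v \<in> coord_space TYPE('f) r. dot r a v = 0} = CARD('f) ^ r"
proof -
  obtain u where "u \<in> coord_space TYPE('f) r" "dot r a u = 1"
    using dot_eq_1'[OF assms] by blast
  then have "int (CARD('f) * card {v \<in> coord_space TYPE('f) r. dot r a v = 0}) = int (CARD('f) ^ r)"
    using sum_eq_card_times_kernel_sum[of u r a "\<lambda>_. 1"] by (simp add: card_coord_space)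
  then show ?thesis by linarith
qed

lemma card_dot_kernel':
  fixes v :: "nat \<Rightarrow> 'f::{field,finite}"
  assumes "v \<in> coord_space TYPE('f) r" "v \<noteq> 0"
  shows "CARD('f) * card {a \<in> coord_space TYPE('f) r. dot r a v = 0} = CARD('f) ^ r"
  using card_dot_kernel[OF assms] by (simp add: dot_commute)

text \<open>Inversion of a finite Radon transform. Summing, over all forms, the level set through
  \<open>x\<close> counts \<open>x\<close> itself \<open>q ^ r\<close> times and every other vector
  only one \<open>q\<close>-th as often. As the total of \<open>D\<close> is zero, a nonzero
  multiple of \<open>D x\<close> is left over.\<close>

lemma hyperplane_sums_zero_imp_zero:
  fixes D :: "(nat \<Rightarrow> 'f::{field,finite}) \<Rightarrow> int"
  assumes zero: "\<And>a c. a \<in> coord_space TYPE('f) r \<Longrightarrow>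
      (\<Sum>v | v \<in> coord_space TYPE('f) r \<and> dot r a v = c. D v) = 0"
    and x: "x \<in> coord_space TYPE('f) r"
  shows "D x = 0"
proof -
  let ?V = "coord_space TYPE('f) r"
  let ?q = "int CARD('f)"
  let ?n = "\<lambda>v. int (card {a \<in> ?V. dot r a (v - x) = 0})"
  have total: "(\<Sum>v\<in>?V. D v) = 0"
    using zero[of 0 0] by (simp add: coord_space_closed)
  \<comment> \<open>For each form the level \<open>c = dot r a x\<close> is chosen, that is, the
    level set through \<open>x\<close>.\<close>
  have "0 = (\<Sum>a\<in>?V. \<Sum>v\<in>{v \<in> ?V. dot r a (v - x) = 0}. D v)"
    using zero by (simp add: dot_diff)
  also have "\<dots> = (\<Sum>v\<in>?V. \<Sum>a\<in>{a \<in> ?V. dot r a (v - x) = 0}. D v)"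
    by (rule sum.swap_restrict) (simp_all add: finite_coord_space)
  also have "\<dots> = (\<Sum>v\<in>?V. ?n v * D v)"
    by simp
  finally have "0 = (\<Sum>v\<in>?V. ?q * (?n v * D v))"
    by (simp flip: sum_distrib_left)
  also have "\<dots> = ?q * (?n x * D x) + (\<Sum>v\<in>?V - {x}. ?q * (?n v * D v))"
    using x by (simp add: sum.remove finite_coord_space)
  also have "(\<Sum>v\<in>?V - {x}. ?q * (?n v * D v)) = (\<Sum>v\<in>?V - {x}. ?q ^ r * D v)"
  proof (rule sum.cong)
    fix v assume "v \<in> ?V - {x}"
    then have "CARD('f) * card {a \<in> ?V. dot r a (v - x) = 0} = CARD('f) ^ r"
      using x by (intro card_dot_kernel') (auto simp: coord_space_closed)
    then have "?q * ?n v = ?q ^ r" by (simp flip: of_nat_mult of_nat_power)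
    then show "?q * (?n v * D v) = ?q ^ r * D v" by (simp only: mult.assoc[symmetric])
  qed simp
  also have "\<dots> = ?q ^ r * (0 - D x)"
    using x total by (simp add: sum_diff1 finite_coord_space flip: sum_distrib_left)
  also have "?n x = ?q ^ r" by (simp add: card_coord_space)
  finally have "?q ^ r * (?q - 1) * D x = 0" by (simp add: algebra_simps)
  then show ?thesis using card_field_ge_2[where ?'f = 'f] by auto
qed

text \<open>Translation by \<open>p\<close> shifts the levels of a form by its value at
  \<open>p\<close>. Scaling makes all nonzero levels carry the same sum, and the hypothesis forces
  the kernel to carry that sum too, unless the form kills \<open>p\<close> and there is no shift. So
  the difference \<open>W (v + p) - W v\<close> has vanishing level sums.\<close>

lemma translation_invariant_if_hyperplane_sums:
  fixes W :: "(nat \<Rightarrow> 'f::{field,finite}) \<Rightarrow> int"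
  assumes scale: "\<And>c v. v \<in> coord_space TYPE('f) r \<Longrightarrow> c \<noteq> 0 \<Longrightarrow> W (fscale c v) = W v"
    and p: "p \<in> coord_space TYPE('f) r"
    and sums: "\<And>a. a \<in> coord_space TYPE('f) r \<Longrightarrow> dot r a p \<noteq> 0 \<Longrightarrow>
      int CARD('f) * (\<Sum>v | v \<in> coord_space TYPE('f) r \<and> dot r a v = 0. W v) =
      (\<Sum>v\<in>coord_space TYPE('f) r. W v)"
    and v: "v \<in> coord_space TYPE('f) r"
  shows "W (v + p) = W v"
proof -
  let ?V = "coord_space TYPE('f) r"
  let ?G = "\<lambda>a c. \<Sum>v | v \<in> ?V \<and> dot r a v = c. W v"
  have "W (v + p) - W v = 0"
  proof (rule hyperplane_sums_zero_imp_zero[where D = "\<lambda>v. W (v + p) - W v", OF _ v])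
    fix a :: "nat \<Rightarrow> 'f" and c
    assume a: "a \<in> ?V"
    have G: "?G a c = ?G a 1" if "c \<noteq> 0" for c
      by (rule sum.reindex_bij_witness[where i = "fscale c" and j = "fscale (inverse c)"])
        (use that in \<open>auto simp: coord_space_closed dot_scale scale\<close>)
    have "?G a (c + dot r a p) = ?G a c"
    proof (cases "dot r a p = 0")
      case False
      have "(\<Sum>v\<in>?V. W v) = (\<Sum>c\<in>UNIV. ?G a c)"
        by (rule sum_dot_fibres)
      also have "\<dots> = ?G a 0 + (\<Sum>c\<in>UNIV - {0}. ?G a c)"
        by (simp add: sum.remove)
      also have "(\<Sum>c\<in>UNIV - {0}. ?G a c) = (\<Sum>c\<in>UNIV - {0::'f}. ?G a 1)"
        by (rule sum.cong) (auto intro: G)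
      also have "\<dots> = (int CARD('f) - 1) * ?G a 1"
        by (simp add: card_Diff_subset of_nat_diff)
      finally have "(int CARD('f) - 1) * ?G a 0 = (int CARD('f) - 1) * ?G a 1"
        using sums[OF a False] by (simp add: algebra_simps)
      then have "?G a 0 = ?G a 1"
        using card_field_ge_2[where ?'f = 'f] by auto
      then have "?G a c = ?G a 1" for c
        using G[of c] by (cases "c = 0") simp_all
      then show ?thesis by metis
    qed simp
    then show "(\<Sum>v | v \<in> ?V \<and> dot r a v = c. W (v + p) - W v) = 0"
      by (simp add: sum_subtractf sum_dot_fibre_translate p)
  qed
  then show ?thesis by simp
qed

text \<open>A form not killing \<open>p\<close> kills exactly one of the \<open>q\<close> vectors
  \<open>v + fscale t p\<close>, which partitions these forms by \<open>t\<close>. The classes are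
  equally large: all these vectors are nonzero, so each is killed by the same number of forms, and a
  form killing \<open>p\<close> kills either all or none of them.\<close>

lemma card_dot_kernel_off_point:
  fixes p v :: "nat \<Rightarrow> 'f::{field,finite}"
  assumes p: "p \<in> coord_space TYPE('f) r"
    and v: "v \<in> coord_space TYPE('f) r" "v \<notin> fvs.span {p}"
  shows "CARD('f) * card {a \<in> coord_space TYPE('f) r. dot r a p \<noteq> 0 \<and> dot r a v = 0} =
    card {a \<in> coord_space TYPE('f) r. dot r a p \<noteq> 0}"
proof -
  let ?V = "coord_space TYPE('f) r"
  let ?A = "{a \<in> ?V. dot r a p \<noteq> 0}"
  let ?v = "\<lambda>t. v + fscale t p"
  have card_eq: "card {a \<in> ?A. dot r a (?v t) = 0} = card {a \<in> ?A. dot r a v = 0}" for t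
  proof -
    have split: "card {a \<in> ?V. dot r a u = 0} =
      card {a \<in> ?A. dot r a u = 0} + card {a \<in> ?V. dot r a p = 0 \<and> dot r a u = 0}" for u
      by (subst card_Un_disjoint[symmetric])
        (auto simp: finite_coord_space intro: arg_cong[where f = card])
    have nz: "?v t \<noteq> 0" for t
    proof
      assume "?v t = 0"
      then have "v = fscale (- t) p" by (simp add: add_eq_0_iff2)
      then show False using v(2) by (simp add: fvs.span_scale fvs.span_base del: fvs.scale_minus_left)
    qed
    have "CARD('f) * card {a \<in> ?V. dot r a (?v t) = 0} = CARD('f) ^ r" for t
      using p v nz by (intro card_dot_kernel') (auto simp: coord_space_closed)
    from this[of t] this[of 0]
    have "CARD('f) * card {a \<in> ?V. dot r a (?v t) = 0} = CARD('f) * card {a \<in> ?V. dot r a v = 0}"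
      by simp
    then have "card {a \<in> ?V. dot r a (?v t) = 0} = card {a \<in> ?V. dot r a v = 0}"
      by (simp only: mult_cancel1) simp
    moreover have "{a \<in> ?V. dot r a p = 0 \<and> dot r a (?v t) = 0} = {a \<in> ?V. dot r a p = 0 \<and> dot r a v = 0}"
      by (auto simp: dot_add dot_scale)
    ultimately show ?thesis using split[of "?v t"] split[of v] by simp
  qed
  have "?A = (\<Union>t. {a \<in> ?A. dot r a (?v t) = 0})"
  proof (intro equalityI subsetI)
    fix a assume "a \<in> ?A"
    then have "a \<in> {a \<in> ?A. dot r a (?v (- dot r a v / dot r a p)) = 0}"
      by (simp add: dot_add dot_diff dot_scale)
    then show "a \<in> (\<Union>t. {a \<in> ?A. dot r a (?v t) = 0})" by blast
  qed auto
  then have "card ?A = card (\<Union>t. {a \<in> ?A. dot r a (?v t) = 0})" by (rule arg_cong)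
  also have "\<dots> = (\<Sum>t\<in>UNIV. card {a \<in> ?A. dot r a (?v t) = 0})"
  proof (rule card_UN_disjoint)
    show "\<forall>s\<in>UNIV. \<forall>t\<in>UNIV. s \<noteq> t \<longrightarrow>
      {a \<in> ?A. dot r a (?v s) = 0} \<inter> {a \<in> ?A. dot r a (?v t) = 0} = {}"
    proof (intro ballI impI equals0I)
      fix s t :: 'f and a
      assume "s \<noteq> t" and a: "a \<in> {a \<in> ?A. dot r a (?v s) = 0} \<inter> {a \<in> ?A. dot r a (?v t) = 0}"
      then have "s * dot r a p = t * dot r a p"
        by (simp add: dot_add dot_scale add_eq_0_iff)
      then show False using a \<open>s \<noteq> t\<close> by simp
    qed
  qed (simp_all add: finite_coord_space)
  also have "\<dots> = CARD('f) * card {a \<in> ?A. dot r a v = 0}"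
    unfolding card_eq by simp
  finally show ?thesis by (simp add: conj_assoc)
qed

text \<open>Double counting of pairs of a form and a vector in its kernel. The vectors in the span
  of \<open>p\<close>, whose share of forms would differ, have value zero.\<close>

lemma sum_kernel_sums_off_point:
  fixes W :: "(nat \<Rightarrow> 'f::{field,finite}) \<Rightarrow> int"
  assumes p: "p \<in> coord_space TYPE('f) r" and zero: "\<And>v. v \<in> fvs.span {p} \<Longrightarrow> W v = 0"
  shows "(\<Sum>a | a \<in> coord_space TYPE('f) r \<and> dot r a p \<noteq> 0.
      int CARD('f) * (\<Sum>v | v \<in> coord_space TYPE('f) r \<and> dot r a v = 0. W v) -
      (\<Sum>v\<in>coord_space TYPE('f) r. W v)) = 0"
proof -
  let ?V = "coord_space TYPE('f) r"
  let ?A = "{a \<in> ?V. dot r a p \<noteq> 0}"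
  have "(\<Sum>a\<in>?A. \<Sum>v | v \<in> ?V \<and> dot r a v = 0. W v) =
    (\<Sum>v\<in>?V. \<Sum>a | a \<in> ?A \<and> dot r a v = 0. W v)"
    by (rule sum.swap_restrict) (simp_all add: finite_coord_space)
  also have "int CARD('f) * \<dots> = (\<Sum>v\<in>?V. int (card ?A) * W v)"
    unfolding sum_distrib_left
  proof (rule sum.cong)
    fix v assume v: "v \<in> ?V"
    show "(\<Sum>a | a \<in> ?A \<and> dot r a v = 0. int CARD('f) * W v) = int (card ?A) * W v"
    proof (cases "v \<in> fvs.span {p}")
      case False
      have "int CARD('f) * int (card {a \<in> ?A. dot r a v = 0}) = int (card ?A)"
        using card_dot_kernel_off_point[OF p v False] by (simp add: conj_assoc flip: of_nat_mult)
      then show ?thesis by (simp add: algebra_simps)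
    qed (simp add: zero)
  qed simp
  finally show ?thesis
    by (simp add: sum_subtractf flip: sum_distrib_left)
qed

section \<open>Projective points\<close>

lemma fscale_apply: "fscale c v i = c * v i"
  by (simp add: fscale_def)

definition points :: "(nat \<Rightarrow> 'f::field) set \<Rightarrow> (nat \<Rightarrow> 'f) set set" where
  "points Z = (\<lambda>v. fvs.span {v}) ` (Z - {0})"

text \<open>For such sets membership of a point does not depend on the representative. Subspaces and
  complements of hyperplanes are both of this kind.\<close>

definition scale_closed :: "(nat \<Rightarrow> 'f::field) set \<Rightarrow> bool" where
  "scale_closed Z \<longleftrightarrow> (\<forall>v\<in>Z. \<forall>c. c \<noteq> 0 \<longrightarrow> fscale c v \<in> Z)"

lemma subspace_imp_scale_closed: "fvs.subspace U \<Longrightarrow> scale_closed U"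
  by (simp add: scale_closed_def fvs.subspace_scale)

lemma scale_closed_off_kernel: "scale_closed {v \<in> coord_space TYPE('f::field) r. dot r a v \<noteq> 0}"
  by (simp add: scale_closed_def coord_space_closed dot_scale)

lemma pointsI: "v \<in> Z \<Longrightarrow> v \<noteq> 0 \<Longrightarrow> fvs.span {v} \<in> points Z"
  by (simp add: points_def)

lemma pointsE:
  assumes "p \<in> points Z"
  obtains v where "v \<in> Z" "v \<noteq> 0" "p = fvs.span {v}"
  using assms by (auto simp: points_def)

lemma points_mono: "A \<subseteq> B \<Longrightarrow> points A \<subseteq> points B"
  by (auto simp: points_def)

lemma finite_points: "finite Z \<Longrightarrow> finite (points Z)"
  by (simp add: points_def)

lemma proj_points_eq: "proj_points F r = points (coord_space F r)"
  by (auto simp: proj_points_def points_def)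

lemma mem_span_singletonE:
  assumes "v \<in> fvs.span {u}" "v \<noteq> 0"
  obtains c where "c \<noteq> 0" "v = fscale c u"
  using assms by (auto simp: fvs.span_singleton)

lemma span_singleton_eqI:
  assumes "v \<in> fvs.span {u}" "v \<noteq> 0"
  shows "fvs.span {v} = fvs.span {u}"
proof -
  obtain c where c: "c \<noteq> 0" "v = fscale c u"
    using assms by (rule mem_span_singletonE)
  then have "u = fscale (inverse c) v" by simp
  then have "u \<in> fvs.span {v}" using fvs.span_scale[OF fvs.span_base[of v "{v}"]] by simp
  then show ?thesis using assms(1) by (simp add: fvs.span_eq)
qed

lemma point_eq_span: "p \<in> points Z \<Longrightarrow> v \<in> p \<Longrightarrow> v \<noteq> 0 \<Longrightarrow> p = fvs.span {v}"
  using span_singleton_eqI by (auto elim!: pointsE)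

lemma span_mem_points_iff:
  assumes "scale_closed Z" "v \<noteq> 0"
  shows "fvs.span {v} \<in> points Z \<longleftrightarrow> v \<in> Z"
proof
  assume "fvs.span {v} \<in> points Z"
  then obtain u where u: "u \<in> Z" "u \<noteq> 0" "fvs.span {v} = fvs.span {u}" by (rule pointsE)
  then have "v \<in> fvs.span {u}" using fvs.span_base by blast
  then show "v \<in> Z"
    using assms u(1) by (auto simp: scale_closed_def elim: mem_span_singletonE)
qed (use assms pointsI in blast)

lemma point_subset_iff:
  assumes "fvs.subspace U" "p \<in> points Z"
  shows "p \<subseteq> U \<longleftrightarrow> p \<in> points U"
proof -
  obtain v where v: "v \<noteq> 0" "p = fvs.span {v}" using assms(2) by (rule pointsE)
  have "p \<subseteq> U \<longleftrightarrow> v \<in> U"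
    using v(2) assms(1) fvs.span_minimal[of "{v}" U] fvs.span_base[of v "{v}"] by auto
  then show ?thesis
    using span_mem_points_iff[OF subspace_imp_scale_closed[OF assms(1)] v(1)] v(2) by simp
qed

lemma points_Int:
  assumes "scale_closed B"
  shows "points A \<inter> points B = points (A \<inter> B)"
proof (intro equalityI subsetI)
  fix p assume p: "p \<in> points A \<inter> points B"
  then obtain v where v: "v \<in> A" "v \<noteq> 0" "p = fvs.span {v}" by (auto elim: pointsE)
  then have "v \<in> B" using p span_mem_points_iff[OF assms v(2)] by simp
  then show "p \<in> points (A \<inter> B)" using v by (simp add: pointsI)
qed (use points_mono[of "A \<inter> B"] in auto)

lemma card_point_nonzero:
  fixes v :: "nat \<Rightarrow> 'f::{field,finite}"
  assumes "v \<noteq> 0"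
  shows "card (fvs.span {v} - {0}) = CARD('f) - 1"
proof -
  have "card (fvs.span {v}) = CARD('f)"
    using assms by (simp add: fvs.span_singleton card_image inj_on_def)
  then show ?thesis
    using fvs.span_zero[of "{v}"] by simp
qed

text \<open>The nonzero vectors of \<open>Z\<close> split into punctured points of
  \<open>q - 1\<close> vectors each.\<close>

lemma card_points:
  fixes Z :: "(nat \<Rightarrow> 'f::{field,finite}) set"
  assumes "finite Z" "scale_closed Z"
  shows "card (points Z) * (CARD('f) - 1) = card (Z - {0})"
proof -
  have sub: "fvs.span {v} - {0} \<subseteq> Z - {0}" if "v \<in> Z" for v
    using assms(2) that by (auto simp: scale_closed_def elim: mem_span_singletonE)
  have "Z - {0} = (\<Union>p\<in>points Z. p - {0})"
  proof (intro equalityI subsetI)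
    fix v assume "v \<in> Z - {0}"
    then show "v \<in> (\<Union>p\<in>points Z. p - {0})"
      using pointsI fvs.span_base[of v "{v}"] by blast
  qed (use sub in \<open>auto elim!: pointsE\<close>)
  then have "card (Z - {0}) = card (\<Union>p\<in>points Z. p - {0})" by simp
  also have "\<dots> = (\<Sum>p\<in>points Z. card (p - {0}))"
  proof (rule card_UN_disjoint)
    show "finite (points Z)" by (rule finite_points[OF assms(1)])
    show "\<forall>p\<in>points Z. finite (p - {0})"
      using sub assms(1) by (auto elim!: pointsE simp: finite_span)
    show "\<forall>p\<in>points Z. \<forall>p'\<in>points Z. p \<noteq> p' \<longrightarrow> (p - {0}) \<inter> (p' - {0}) = {}"
    proof (intro ballI impI equals0I)
      fix p p' v assume "p \<in> points Z" "p' \<in> points Z" "p \<noteq> p'" "v \<in> (p - {0}) \<inter> (p' - {0})"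
      then show False using point_eq_span[of p Z v] point_eq_span[of p' Z v] by simp
    qed
  qed
  also have "\<dots> = (\<Sum>p\<in>points Z. CARD('f) - 1)"
    by (rule sum.cong) (auto elim!: pointsE simp: card_point_nonzero)
  finally show ?thesis by simp
qed

lemma card_points_subspace:
  fixes U :: "(nat \<Rightarrow> 'f::{field,finite}) set"
  assumes "finite U" "fvs.subspace U"
  shows "card (points U) * (CARD('f) - 1) = CARD('f) ^ fvs.dim U - 1"
  using card_points[OF assms(1) subspace_imp_scale_closed[OF assms(2)]] assms
  by (simp add: fvs.subspace_0 flip: card_subspace)

text \<open>Links rank in \<open>PG\<close>, the dimension of a union of points, to the dimension of
  chosen representatives.\<close>

lemma span_Union_points: "fvs.span (\<Union> ((\<lambda>v. fvs.span {v}) ` B)) = fvs.span B"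
proof -
  have "fvs.span {v} \<subseteq> fvs.span B" if "v \<in> B" for v
    using that by (intro fvs.span_mono) simp
  moreover have "B \<subseteq> \<Union> ((\<lambda>v. fvs.span {v}) ` B)"
    using fvs.span_base by blast
  ultimately show ?thesis
    unfolding fvs.span_eq using fvs.span_superset by blast
qed

lemma dim_Union_points: "fvs.dim (\<Union> ((\<lambda>v. fvs.span {v}) ` B)) = fvs.dim B"
  by (rule fvs.span_eq_dim) (rule span_Union_points)

lemma Union_points_subset: "fvs.subspace U \<Longrightarrow> X \<subseteq> points U \<Longrightarrow> \<Union>X \<subseteq> U"
  using point_subset_iff by blast

section \<open>Isomorphisms\<close>

lemma isomorphic_sym:
  assumes "isomorphic M N"
  shows "isomorphic N M"
proof -
  obtain f where f: "bij_betw f (ground M) (ground N)"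
    "\<And>X. X \<subseteq> ground M \<Longrightarrow> indep M X \<longleftrightarrow> indep N (f ` X)"
    using assms by (auto simp: isomorphic_def matroid_iso_def)
  let ?g = "inv_into (ground M) f"
  have g: "bij_betw ?g (ground N) (ground M)"
    by (rule bij_betw_inv_into[OF f(1)])
  have "indep N X \<longleftrightarrow> indep M (?g ` X)" if "X \<subseteq> ground N" for X
  proof -
    have "?g ` X \<subseteq> ground M" using g that by (auto simp: bij_betw_def)
    moreover have "f ` ?g ` X = X"
      using f(1) that by (simp add: bij_betw_def image_inv_into_cancel)
    ultimately show ?thesis using f(2) by metis
  qed
  then show ?thesis using g by (auto simp: isomorphic_def matroid_iso_def)
qed

lemma isomorphic_trans:
  assumes "isomorphic L M" "isomorphic M N"
  shows "isomorphic L N"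
proof -
  obtain f where f: "bij_betw f (ground L) (ground M)"
    "\<And>X. X \<subseteq> ground L \<Longrightarrow> indep L X \<longleftrightarrow> indep M (f ` X)"
    using assms(1) by (auto simp: isomorphic_def matroid_iso_def)
  obtain g where g: "bij_betw g (ground M) (ground N)"
    "\<And>X. X \<subseteq> ground M \<Longrightarrow> indep M X \<longleftrightarrow> indep N (g ` X)"
    using assms(2) by (auto simp: isomorphic_def matroid_iso_def)
  have "indep L X \<longleftrightarrow> indep N ((g \<circ> f) ` X)" if "X \<subseteq> ground L" for X
  proof -
    have "f ` X \<subseteq> ground M" using f(1) that by (auto simp: bij_betw_def)
    then show ?thesis using f(2)[OF that] g(2) by (simp add: image_comp)
  qed
  then show ?thesis
    using bij_betw_trans[OF f(1) g(1)] unfolding isomorphic_def matroid_iso_def by blast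
qed

lemma ground_PG [simp]: "ground (PG F r) = points (coord_space F r)"
  by (simp add: PG_def proj_points_eq)

lemma indep_PG: "indep (PG F r) X \<longleftrightarrow> X \<subseteq> points (coord_space F r) \<and> fvs.dim (\<Union>X) = card X"
  by (simp add: PG_def proj_points_eq)

lemma ground_restriction [simp]: "ground (restriction M X) = ground M \<inter> X"
  and indep_restriction [simp]: "indep (restriction M X) Y \<longleftrightarrow> indep M Y \<and> Y \<subseteq> X"
  by (simp_all add: restriction_def)

lemma restriction_PG_all: "restriction (PG F r) (points (coord_space F r)) = PG F r"
  by (auto simp: restriction_def PG_def proj_points_eq fun_eq_iff)

text \<open>\<open>Z\<close> may be smaller than the subspace on which \<open>T\<close> is
  injective; this lets one statement serve both subspaces and complements of hyperplanes.\<close>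

lemma restriction_PG_iso:
  fixes T :: "(nat \<Rightarrow> 'f::{field,finite}) \<Rightarrow> nat \<Rightarrow> 'f"
  assumes hom: "module_hom fscale fscale T"
    and A: "fvs.subspace A" "A \<subseteq> coord_space TYPE('f) n" "inj_on T A"
    and TA: "T ` A \<subseteq> coord_space TYPE('f) m" and Z: "Z \<subseteq> A"
  shows "isomorphic (restriction (PG TYPE('f) n) (points Z)) (restriction (PG TYPE('f) m) (points (T ` Z)))"
proof -
  have T_span: "T ` fvs.span {v} = fvs.span {T v}" for v
    using module_hom.span_image[OF hom, of "{v}"] by simp
  have T_nz: "T v \<noteq> 0" if "v \<in> A" "v \<noteq> 0" for v
    using module_hom.inj_on_iff_eq_0[OF hom A(1)] A(3) that by blast
  have sub: "p \<subseteq> A" if "p \<in> points Z" for p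
    using that Z point_subset_iff[OF A(1)] points_mono by blast
  have inj: "inj_on ((`) T) (points Z)"
    using sub inj_on_image_eq_iff[OF A(3)] by (auto intro!: inj_onI)
  have img: "(`) T ` points Z = points (T ` Z)"
  proof (intro equalityI subsetI)
    fix p assume "p \<in> (`) T ` points Z"
    then show "p \<in> points (T ` Z)"
      using T_nz[OF subsetD[OF Z]] Z by (auto simp: T_span elim!: pointsE intro!: pointsI)
  next
    fix p assume "p \<in> points (T ` Z)"
    then obtain v where "v \<in> Z" "T v \<noteq> 0" "p = fvs.span {T v}"
      by (auto elim!: pointsE)
    moreover have "v \<noteq> 0" using calculation(2) module_hom.zero[OF hom] by auto
    ultimately show "p \<in> (`) T ` points Z"
      by (intro image_eqI[of _ _ "fvs.span {v}"]) (simp_all add: T_span pointsI)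
  qed
  have sub_n: "points Z \<subseteq> points (coord_space TYPE('f) n)"
    and sub_m: "points (T ` Z) \<subseteq> points (coord_space TYPE('f) m)"
    using A(2) TA Z by (auto intro!: points_mono)
  have "indep (restriction (PG TYPE('f) n) (points Z)) X \<longleftrightarrow>
    indep (restriction (PG TYPE('f) m) (points (T ` Z))) ((`) T ` X)" if X: "X \<subseteq> points Z" for X
  proof -
    have UX: "\<Union>X \<subseteq> A" using X sub by blast
    have "finite (\<Union>X)"
      by (rule finite_subset[OF subset_trans[OF UX A(2)] finite_coord_space])
    moreover have "inj_on T (fvs.span (\<Union>X))"
      using A(3) fvs.span_minimal[OF UX A(1)] inj_on_subset by blast
    ultimately have "fvs.dim (T ` \<Union>X) = fvs.dim (\<Union>X)"
      using dim_linear_image hom by blast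
    moreover have "\<Union> ((`) T ` X) = T ` \<Union>X" by auto
    moreover have "card ((`) T ` X) = card X"
      using inj X by (meson card_image inj_on_subset)
    moreover have "(`) T ` X \<subseteq> points (T ` Z)" using X img by auto
    ultimately show ?thesis using X sub_n sub_m by (auto simp: indep_PG)
  qed
  moreover have "bij_betw ((`) T) (points Z) (points (T ` Z))"
    using inj img by (simp add: bij_betw_def)
  ultimately have "matroid_iso ((`) T) (restriction (PG TYPE('f) n) (points Z))
      (restriction (PG TYPE('f) m) (points (T ` Z)))"
    using sub_n sub_m by (simp add: matroid_iso_def Int_absorb1)
  then show ?thesis unfolding isomorphic_def by blast
qed

lemma restriction_subspace_iso_PG:
  fixes U :: "(nat \<Rightarrow> 'f::{field,finite}) set"
  assumes "fvs.subspace U" "U \<subseteq> coord_space TYPE('f) r"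
  shows "isomorphic (restriction (PG TYPE('f) r) (points U)) (PG TYPE('f) (fvs.dim U))"
proof -
  have "finite U" using assms(2) finite_coord_space finite_subset by blast
  then obtain T where T: "module_hom fscale fscale T" "inj_on T (coord_space TYPE('f) (fvs.dim U))"
    "T ` coord_space TYPE('f) (fvs.dim U) = U"
    using linear_iso_coord_space[of U] fvs.span_eq_iff[THEN iffD2, OF assms(1)] by auto
  have "isomorphic (restriction (PG TYPE('f) (fvs.dim U)) (points (coord_space TYPE('f) (fvs.dim U))))
      (restriction (PG TYPE('f) r) (points (T ` coord_space TYPE('f) (fvs.dim U))))"
    by (rule restriction_PG_iso[OF T(1) subspace_coord_space subset_refl T(2)])
      (use T(3) assms(2) in auto)
  then show ?thesis
    using T(3) by (simp add: restriction_PG_all isomorphic_sym)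
qed

lemma AG_eq:
  "AG TYPE('f::field) r = restriction (PG TYPE('f) r) (points {v \<in> coord_space TYPE('f) r. v 0 \<noteq> 0})"
proof -
  have "{p \<in> proj_points TYPE('f) r. \<not> p \<subseteq> {v. v 0 = 0}} =
    points {v \<in> coord_space TYPE('f) r. v 0 \<noteq> 0}"
    unfolding proj_points_eq
  proof (intro equalityI subsetI)
    fix p assume "p \<in> {p \<in> points (coord_space TYPE('f) r). \<not> p \<subseteq> {v. v 0 = 0}}"
    then obtain u where u: "u \<in> coord_space TYPE('f) r" "u \<noteq> 0" "p = fvs.span {u}"
      and "\<not> p \<subseteq> {v. v 0 = 0}" by (auto elim!: pointsE)
    then have "u 0 \<noteq> 0" by (auto simp: fvs.span_singleton fscale_def)
    then show "p \<in> points {v \<in> coord_space TYPE('f) r. v 0 \<noteq> 0}"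
      using u by (auto intro: pointsI)
  next
    fix p assume "p \<in> points {v \<in> coord_space TYPE('f) r. v 0 \<noteq> 0}"
    then obtain u where u: "u \<in> coord_space TYPE('f) r" "u 0 \<noteq> 0" "u \<noteq> 0" "p = fvs.span {u}"
      by (auto elim!: pointsE)
    then show "p \<in> {p \<in> points (coord_space TYPE('f) r). \<not> p \<subseteq> {v. v 0 = 0}}"
      using fvs.span_base[of u "{u}"] by (auto intro: pointsI)
  qed
  then show ?thesis by (simp add: AG_def)
qed

lemma restriction_off_kernel_iso_AG:
  fixes a :: "nat \<Rightarrow> 'f::{field,finite}"
  assumes a: "a \<in> coord_space TYPE('f) r" "a \<noteq> 0"
  shows "isomorphic (restriction (PG TYPE('f) r) (points {v \<in> coord_space TYPE('f) r. dot r a v \<noteq> 0}))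
    (AG TYPE('f) r)"
proof -
  let ?V = "coord_space TYPE('f) r"
  obtain i where i: "a i \<noteq> 0" using a(2) by (auto simp: fun_eq_iff)
  then have ir: "i < r" using a(1) by (intro ccontr[of "i < r"]) (simp add: coord_space_def)
  \<comment> \<open>coordinate \<open>i\<close> is traded for the value of the form, which is stored as coordinate \<open>0\<close>\<close>
  define T where "T = (\<lambda>v j. if j = 0 then dot r a v else if j = i then v 0 else v j)"
  have hom: "module_hom fscale fscale T"
    unfolding module_hom_iff
    by (intro conjI allI fvs.module_axioms)
      (auto simp: T_def dot_add dot_scale fscale_apply fun_eq_iff)
  have TV: "T ` ?V \<subseteq> ?V" using ir by (auto simp: T_def coord_space_def)
  have "v = 0" if "v \<in> ?V" "T v = 0" for v
  proof -
    have dot: "dot r a v = 0" using fun_cong[OF that(2), of 0] by (simp add: T_def)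
    have rest: "v j = 0" if "j \<noteq> i" for j
    proof (cases "j = 0")
      case True
      then show ?thesis using fun_cong[OF \<open>T v = 0\<close>, of i] that by (simp add: T_def)
    next
      case False
      then show ?thesis using fun_cong[OF \<open>T v = 0\<close>, of j] that by (simp add: T_def)
    qed
    have "dot r a v = (\<Sum>j<r. if j = i then a i * v i else 0)"
      unfolding dot_def by (rule sum.cong) (auto simp: rest)
    then have "v i = 0" using dot ir i by simp
    then have "v j = 0" for j using rest[of j] by (cases "j = i") auto
    then show ?thesis by (simp add: fun_eq_iff)
  qed
  then have inj: "inj_on T ?V"
    using module_hom.inj_on_iff_eq_0[OF hom subspace_coord_space] by blast
  then have surj: "T ` ?V = ?V"
    using TV by (simp add: endo_inj_surj finite_coord_space)
  have "T ` {v \<in> ?V. dot r a v \<noteq> 0} = {v \<in> T ` ?V. v 0 \<noteq> 0}"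
    by (auto simp: T_def)
  then have "T ` {v \<in> ?V. dot r a v \<noteq> 0} = {v \<in> ?V. v 0 \<noteq> 0}"
    by (simp only: surj)
  then show ?thesis
    using restriction_PG_iso[OF hom subspace_coord_space subset_refl inj TV, of "{v \<in> ?V. dot r a v \<noteq> 0}"]
    by (auto simp: AG_eq)
qed

section \<open>Lines\<close>

text \<open>Phrased through independence alone, so that isomorphisms preserve it. The cases
  \<open>z = x\<close> and \<open>z = y\<close> are listed separately because the triple then
  collapses to a pair, which is independent in a simple matroid.\<close>

definition line :: "'a set_system \<Rightarrow> 'a \<Rightarrow> 'a \<Rightarrow> 'a set" where
  "line N x y = {z \<in> ground N. z = x \<or> z = y \<or> \<not> indep N {x, y, z}}"

lemma card_line_iso:
  assumes "matroid_iso f M N" "x \<in> ground M" "y \<in> ground M"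
  shows "card (line N (f x) (f y)) = card (line M x y)"
proof -
  have inj: "inj_on f (ground M)" and img: "f ` ground M = ground N"
    and ind: "\<And>X. X \<subseteq> ground M \<Longrightarrow> indep M X \<longleftrightarrow> indep N (f ` X)"
    using assms(1) by (auto simp: matroid_iso_def bij_betw_def)
  have "f z \<in> line N (f x) (f y) \<longleftrightarrow> z \<in> line M x y" if "z \<in> ground M" for z
    using ind[of "{x, y, z}"] that assms(2,3) img inj
    by (auto simp: line_def dest: inj_onD)
  moreover have "line N (f x) (f y) \<subseteq> f ` ground M" "line M x y \<subseteq> ground M"
    using img by (auto simp: line_def)
  ultimately have "line N (f x) (f y) = f ` line M x y" by blast
  moreover have "inj_on f (line M x y)"
    using inj by (rule inj_on_subset) (auto simp: line_def)
  ultimately show ?thesis by (simp add: card_image)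
qed

lemma line_restriction: "x \<in> X \<Longrightarrow> y \<in> X \<Longrightarrow> line (restriction N X) x y = line N x y \<inter> X"
  by (auto simp: line_def)

text \<open>A third point is dependent on two distinct ones exactly when its representative lies in
  their span, since otherwise the dimension rises to three. Matroid lines are therefore
  two-dimensional subspaces.\<close>

lemma
  fixes x y :: "(nat \<Rightarrow> 'f::{field,finite}) set"
  assumes x: "x \<in> points (coord_space TYPE('f) r)" and y: "y \<in> points (coord_space TYPE('f) r)"
    and "x \<noteq> y"
  shows dim_two_points: "fvs.dim (x \<union> y) = 2"
    and span_two_points_subset: "fvs.span (x \<union> y) \<subseteq> coord_space TYPE('f) r"
    and line_PG: "line (PG TYPE('f) r) x y = points (fvs.span (x \<union> y))"
proof -
  let ?V = "coord_space TYPE('f) r"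
  obtain u where u: "u \<in> ?V" "u \<noteq> 0" "x = fvs.span {u}" using x by (rule pointsE)
  obtain v where v: "v \<in> ?V" "v \<noteq> 0" "y = fvs.span {v}" using y by (rule pointsE)
  have span: "fvs.span (x \<union> y) = fvs.span {u, v}"
    using span_Union_points[of "{u, v}"] u v by simp
  have "fvs.dim (insert v {u}) = Suc (fvs.dim {u})"
    using span_singleton_eqI[of v u] u v assms(3) by (intro dim_insert_notin) auto
  moreover have "fvs.dim {u} = 1"
    using u(2) independent_iff_dim[of "{u}"] by simp
  ultimately have dim2: "fvs.dim {u, v} = 2" by (simp add: insert_commute)
  then show "fvs.dim (x \<union> y) = 2"
    using fvs.span_eq_dim[OF span] by simp
  show sub: "fvs.span (x \<union> y) \<subseteq> ?V"
    unfolding span using u(1) v(1) by (intro fvs.span_minimal subspace_coord_space) simp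
  show "line (PG TYPE('f) r) x y = points (fvs.span (x \<union> y))"
  proof (rule set_eqI)
    fix z
    show "z \<in> line (PG TYPE('f) r) x y \<longleftrightarrow> z \<in> points (fvs.span (x \<union> y))"
    proof (cases "z \<in> points ?V")
      case True
      then obtain w where w: "w \<in> ?V" "w \<noteq> 0" "z = fvs.span {w}" by (rule pointsE)
      have mem: "z \<in> points (fvs.span (x \<union> y)) \<longleftrightarrow> w \<in> fvs.span {u, v}"
        unfolding w(3) span
        by (rule span_mem_points_iff[OF subspace_imp_scale_closed[OF fvs.subspace_span] w(2)])
      have dim: "fvs.dim (\<Union>{x, y, z}) = fvs.dim {w, u, v}"
        using dim_Union_points[of "{w, u, v}"] u(3) v(3) w(3) by (simp add: Un_ac)
      have card3: "card {x, y, z} = 3" if "z \<noteq> x" "z \<noteq> y"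
        using that assms(3) by (simp add: card_insert_if)
      show ?thesis
      proof (cases "w \<in> fvs.span {u, v}")
        case True
        then have "fvs.dim {w, u, v} = 2"
          using fvs.span_eq_dim[OF fvs.span_redundant[OF True]] dim2 by simp
        then have "z = x \<or> z = y \<or> \<not> indep (PG TYPE('f) r) {x, y, z}"
          using dim card3 by (force simp only: indep_PG)
        then show ?thesis
          using True mem \<open>z \<in> points ?V\<close> by (simp add: line_def)
      next
        case False
        then have "fvs.dim {w, u, v} = 3"
          using dim_insert_notin[of "{u, v}" w] dim2 by simp
        moreover have "z \<noteq> x" "z \<noteq> y"
        proof -
          have "x \<subseteq> fvs.span {u, v}" "y \<subseteq> fvs.span {u, v}"
            unfolding u(3) v(3) by (simp_all add: fvs.span_mono)
          then show "z \<noteq> x" "z \<noteq> y" using False w(3) fvs.span_base[of w "{w}"] by auto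
        qed
        ultimately have "z \<notin> line (PG TYPE('f) r) x y"
          using x y dim card3 \<open>z \<in> points ?V\<close> by (simp add: line_def indep_PG)
        then show ?thesis using False mem by simp
      qed
    next
      case False
      then show ?thesis using points_mono[OF sub] by (auto simp: line_def)
    qed
  qed
qed

lemma two_points_mem_span:
  assumes "x \<in> points A" "y \<in> points A"
  shows "x \<in> points (fvs.span (x \<union> y))" "y \<in> points (fvs.span (x \<union> y))"
proof -
  have "x \<subseteq> fvs.span (x \<union> y)" "y \<subseteq> fvs.span (x \<union> y)"
    using fvs.span_superset[of "x \<union> y"] by auto
  then show "x \<in> points (fvs.span (x \<union> y))" "y \<in> points (fvs.span (x \<union> y))"
    using assms point_subset_iff by blast+
qed

lemma finite_point:
  fixes x :: "(nat \<Rightarrow> 'f::{field,finite}) set"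
  shows "x \<in> points A \<Longrightarrow> finite x"
  by (auto elim!: pointsE simp: finite_span)

lemma card_points_line:
  fixes x y :: "(nat \<Rightarrow> 'f::{field,finite}) set"
  assumes "x \<in> points (coord_space TYPE('f) r)" "y \<in> points (coord_space TYPE('f) r)" "x \<noteq> y"
  shows "card (points (fvs.span (x \<union> y))) = CARD('f) + 1"
proof -
  have "finite (x \<union> y)" using assms finite_point by blast
  then have "card (points (fvs.span (x \<union> y))) * (CARD('f) - 1) = CARD('f) ^ 2 - 1"
    using card_points_subspace[OF finite_span fvs.subspace_span, of "x \<union> y"] dim_two_points[OF assms]
    by simp
  also have "\<dots> = (CARD('f) + 1) * (CARD('f) - 1)"
    using card_field_ge_2[where ?'f = 'f] by (simp add: power2_eq_square algebra_simps)
  finally show ?thesis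
    using card_field_ge_2[where ?'f = 'f] by (simp only: mult_cancel2) simp
qed

lemma line_exchange:
  fixes x y z :: "(nat \<Rightarrow> 'f::{field,finite}) set"
  assumes x: "x \<in> points (coord_space TYPE('f) r)" and y: "y \<in> points (coord_space TYPE('f) r)"
    and z: "z \<in> points (fvs.span (x \<union> y))" and ne: "x \<noteq> y" "z \<noteq> x"
  shows "fvs.span (x \<union> z) = fvs.span (x \<union> y)"
proof (rule subspace_eqI_dim)
  have zV: "z \<in> points (coord_space TYPE('f) r)"
    using z points_mono[OF span_two_points_subset[OF x y ne(1)]] by blast
  show "finite (fvs.span (x \<union> y))" using x y finite_point by (intro finite_span) blast
  have "z \<subseteq> fvs.span (x \<union> y)" using z point_subset_iff[OF fvs.subspace_span] by blast
  then show "fvs.span (x \<union> z) \<subseteq> fvs.span (x \<union> y)"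
    using fvs.span_superset[of "x \<union> y"] by (intro fvs.span_minimal fvs.subspace_span) auto
  show "fvs.dim (fvs.span (x \<union> y)) \<le> fvs.dim (fvs.span (x \<union> z))"
    using dim_two_points[OF x y ne(1)] dim_two_points[OF x zV] ne by simp
qed simp_all

section \<open>Recognising subspaces and affine geometries by their lines\<close>

lemma line_closed_imp_subspace:
  assumes "C \<subseteq> points (coord_space TYPE('f::{field,finite}) r)"
    and closed: "\<And>x y. x \<in> C \<Longrightarrow> y \<in> C \<Longrightarrow> x \<noteq> y \<Longrightarrow> points (fvs.span (x \<union> y)) \<subseteq> C"
  shows "\<exists>U. fvs.subspace U \<and> U \<subseteq> coord_space TYPE('f) r \<and> C = points U"
proof -
  \<comment> \<open>\<open>0\<close> is inserted separately because \<open>C\<close> may be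
    empty.\<close>
  define U where "U = insert 0 (\<Union>C)"
  have span_mem: "fvs.span {v} \<in> C" if "v \<in> U" "v \<noteq> 0" for v
  proof -
    obtain p where "p \<in> C" "v \<in> p" using \<open>v \<in> U\<close> \<open>v \<noteq> 0\<close> by (auto simp: U_def)
    then show ?thesis using assms(1) point_eq_span that(2) by blast
  qed
  have memI: "v \<in> U" if "p \<in> C" "v \<in> p" for p v
    using that by (auto simp: U_def)
  have "fvs.subspace U"
  proof (rule fvs.subspaceI)
    show "0 \<in> U" by (simp add: U_def)
    show "fscale c v \<in> U" if "v \<in> U" for c v
    proof (cases "v = 0")
      case False
      then show ?thesis
        using memI[OF span_mem[OF that False]] fvs.span_scale fvs.span_base[of v "{v}"] by blast
    qed (simp add: U_def)
    show "u + v \<in> U" if "u \<in> U" "v \<in> U" for u v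
    proof (cases "u = 0 \<or> v = 0 \<or> u + v = 0")
      case True
      then show ?thesis using that \<open>0 \<in> U\<close> by fastforce
    next
      case False
      have uv: "u \<in> fvs.span {u}" "v \<in> fvs.span {v}" by (simp_all add: fvs.span_base)
      show ?thesis
      proof (cases "fvs.span {u} = fvs.span {v}")
        case True
        then have "u + v \<in> fvs.span {v}" using uv fvs.span_add by blast
        then show ?thesis using memI span_mem that(2) False by blast
      next
        case ne: False
        have "u + v \<in> fvs.span (fvs.span {u} \<union> fvs.span {v})"
          using uv by (intro fvs.span_add) (auto intro: fvs.span_base)
        then have "fvs.span {u + v} \<in> C"
          using closed[OF span_mem span_mem ne] that False pointsI by blast
        then show ?thesis using memI fvs.span_base[of "u + v" "{u + v}"] by blast
      qed
    qed
  qed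
  moreover have "U \<subseteq> coord_space TYPE('f) r"
    using Union_points_subset[OF subspace_coord_space assms(1)] by (simp add: U_def coord_space_zero)
  moreover have "C = points U"
  proof (intro equalityI subsetI)
    fix p assume p: "p \<in> C"
    then obtain v where "v \<noteq> 0" "p = fvs.span {v}" using assms(1) by (blast elim: pointsE)
    then show "p \<in> points U" using memI[OF p] fvs.span_base[of v "{v}"] by (auto intro: pointsI)
  qed (use span_mem in \<open>auto elim!: pointsE\<close>)
  ultimately show ?thesis by blast
qed

text \<open>Inside \<open>C\<close> a line has as many points as a line of the model, namely
  \<open>q + 1\<close>. A line of the surrounding space has no more, so \<open>C\<close> contains
  the whole line. The dimension is then read off from the number of points.\<close>

lemma restriction_iso_PG_imp_subspace:
  assumes C: "C \<subseteq> points (coord_space TYPE('f::{field,finite}) r)"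
    and iso: "isomorphic (restriction (PG TYPE('f) r) C) (PG TYPE('f) k)"
  shows "\<exists>U. fvs.subspace U \<and> U \<subseteq> coord_space TYPE('f) r \<and> C = points U \<and> fvs.dim U = k"
proof -
  let ?N = "restriction (PG TYPE('f) r) C"
  obtain f where f: "matroid_iso f ?N (PG TYPE('f) k)" using iso by (auto simp: isomorphic_def)
  have gr: "ground ?N = C" using C by auto
  have bij: "bij_betw f C (points (coord_space TYPE('f) k))"
    using f gr by (simp add: matroid_iso_def)
  have "points (fvs.span (x \<union> y)) \<subseteq> C" if xy: "x \<in> C" "y \<in> C" "x \<noteq> y" for x y
  proof -
    have f_mem: "f x \<in> points (coord_space TYPE('f) k)" "f y \<in> points (coord_space TYPE('f) k)" "f x \<noteq> f y"
      using bij xy by (auto simp: bij_betw_def inj_on_def)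
    have xyV: "x \<in> points (coord_space TYPE('f) r)" "y \<in> points (coord_space TYPE('f) r)"
      using C xy by auto
    have "card (points (fvs.span (x \<union> y)) \<inter> C) = CARD('f) + 1"
      using card_line_iso[OF f, of x y] xy xyV gr card_points_line[OF f_mem]
      by (simp add: line_restriction line_PG[OF xyV xy(3)] line_PG[OF f_mem])
    then have "points (fvs.span (x \<union> y)) \<inter> C = points (fvs.span (x \<union> y))"
      using card_points_line[OF xyV xy(3)] finite_point xyV
      by (intro card_subset_eq finite_points finite_span) auto
    then show ?thesis by blast
  qed
  then obtain U where U: "fvs.subspace U" "U \<subseteq> coord_space TYPE('f) r" "C = points U"
    using line_closed_imp_subspace[OF C] by blast
  have fin: "finite U" using U(2) finite_coord_space finite_subset by blast
  have "CARD('f) ^ fvs.dim U - 1 = CARD('f) ^ k - 1"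
    using card_points_subspace[OF fin U(1)] bij_betw_same_card[OF bij] U(3)
      card_points_subspace[OF finite_coord_space subspace_coord_space[where ?'f = 'f], of k]
    by (simp add: dim_coord_space)
  then have "CARD('f) ^ fvs.dim U = CARD('f) ^ k"
    using card_field_ge_2[where ?'f = 'f] by (simp add: eq_diff_iff)
  then have "fvs.dim U = k"
    using card_field_ge_2[where ?'f = 'f] by (simp add: power_inject_exp)
  then show ?thesis using U by blast
qed

text \<open>The form restricted to the two-dimensional span is nonzero, so its kernel there is a
  single point, and \<open>q\<close> of the \<open>q + 1\<close> points remain.\<close>

lemma card_line_off_kernel:
  fixes a :: "nat \<Rightarrow> 'f::{field,finite}" and r :: nat
  defines "N \<equiv> points {v \<in> coord_space TYPE('f) r. dot r a v \<noteq> 0}"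
  assumes "x \<in> N" "y \<in> N" "x \<noteq> y"
  shows "card (points (fvs.span (x \<union> y)) \<inter> N) = CARD('f)"
proof -
  let ?V = "coord_space TYPE('f) r" and ?q = "CARD('f)"
  let ?L = "fvs.span (x \<union> y)"
  let ?K = "{v \<in> ?L. dot r a v = 0}"
  have NV: "N \<subseteq> points ?V" unfolding N_def by (rule points_mono) auto
  have xyV: "x \<in> points ?V" "y \<in> points ?V" using NV assms by auto
  have LV: "?L \<subseteq> ?V" by (rule span_two_points_subset[OF xyV assms(4)])
  then have fin: "finite ?L" using finite_coord_space finite_subset by blast
  have dimL: "fvs.dim ?L = 2" using dim_two_points[OF xyV assms(4)] by simp
  have subK: "fvs.subspace ?K"
    by (rule fvs.subspaceI) (auto simp: fvs.span_zero fvs.span_add fvs.span_scale dot_add dot_scale)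
  obtain u where u: "dot r a u \<noteq> 0" "x = fvs.span {u}"
    using assms(2) unfolding N_def by (auto elim: pointsE)
  obtain v where v: "v \<noteq> 0" "dot r a v \<noteq> 0" "y = fvs.span {v}"
    using assms(3) unfolding N_def by (auto elim: pointsE)
  have uL: "u \<in> ?L" and vL: "v \<in> ?L"
    using u(2) v(3) fvs.span_base[of u "{u}"] fvs.span_base[of v "{v}"] fvs.span_base by blast+
  have "fvs.dim ?K < 2"
  proof (rule ccontr)
    assume "\<not> fvs.dim ?K < 2"
    then have "?K = ?L"
      using dimL by (intro subspace_eqI_dim[OF fin subK fvs.subspace_span]) auto
    then show False using uL u(1) by blast
  qed
  moreover have "fvs.dim ?K \<noteq> 0"
  proof
    assume "fvs.dim ?K = 0"
    then have "card ?K = 1" using card_subspace[OF _ subK] fin by simp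
    then obtain z where "?K = {z}" by (rule card_1_singletonE)
    then have K0: "?K = {0}" using fvs.subspace_0[OF subK] by simp
    \<comment> \<open>The combination of \<open>u\<close> and \<open>v\<close> that the form kills;
      it vanishes only if the two points coincide.\<close>
    let ?w = "v - fscale (dot r a v / dot r a u) u"
    have "?w \<in> ?K" using uL vL u(1) by (simp add: fvs.span_diff fvs.span_scale dot_diff dot_scale)
    then have "v = fscale (dot r a v / dot r a u) u" using K0 by simp
    then have "v \<in> x"
      unfolding u(2) by (metis fvs.span_base fvs.span_scale singletonI)
    then show False using v assms(4) span_singleton_eqI u(2) by blast
  qed
  ultimately have "fvs.dim ?K = 1" by simp
  then have cardK: "card ?K = ?q" using card_subspace[OF _ subK] fin by simp
  have "points ?L \<inter> N = points (?L \<inter> {v \<in> ?V. dot r a v \<noteq> 0})"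
    unfolding N_def by (rule points_Int[OF scale_closed_off_kernel])
  also have "?L \<inter> {v \<in> ?V. dot r a v \<noteq> 0} = ?L - ?K" using LV by auto
  finally have eq: "points ?L \<inter> N = points (?L - ?K)" .
  have "scale_closed (?L - ?K)"
    by (auto simp: scale_closed_def dot_scale fvs.span_scale)
  then have "card (points (?L - ?K)) * (?q - 1) = card (?L - ?K - {0})"
    using card_points fin by blast
  also have "?L - ?K - {0} = ?L - ?K" by (auto simp: fvs.span_zero)
  also have "card (?L - ?K) = ?q ^ 2 - ?q"
    using card_Diff_subset[of ?K ?L] fin cardK card_subspace[OF fin fvs.subspace_span] dimL by auto
  also have "\<dots> = ?q * (?q - 1)" by (simp add: power2_eq_square diff_mult_distrib2)
  finally show ?thesis using eq card_field_ge_2[where ?'f = 'f] by simp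
qed

lemma card_points_off_kernel:
  fixes a :: "nat \<Rightarrow> 'f::{field,finite}"
  assumes "a \<in> coord_space TYPE('f) r" "a \<noteq> 0"
  shows "CARD('f) * card (points {v \<in> coord_space TYPE('f) r. dot r a v \<noteq> 0}) = CARD('f) ^ r"
proof -
  let ?V = "coord_space TYPE('f) r" and ?q = "CARD('f)"
  let ?H = "{v \<in> ?V. dot r a v = 0}"
  let ?Z = "{v \<in> ?V. dot r a v \<noteq> 0}"
  have "card (points ?Z) * (?q - 1) = card (?Z - {0})"
    by (intro card_points scale_closed_off_kernel) (simp add: finite_coord_space)
  also have "?Z - {0} = ?V - ?H" by auto
  also have "card (?V - ?H) = ?q ^ r - card ?H"
    using card_Diff_subset[of ?H ?V] finite_coord_space[where ?'f = 'f and n = r]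
    by (simp add: card_coord_space)
  also have "\<dots> = card ?H * (?q - 1)"
    using card_dot_kernel[OF assms] by (simp add: algebra_simps)
  finally show ?thesis
    using card_dot_kernel[OF assms] card_field_ge_2[where ?'f = 'f] by simp
qed

text \<open>Every line that contains two points of \<open>N\<close> meets \<open>N\<close> in \<open>q\<close> points, hence has exactly one
  point outside \<open>N\<close>. Counting the pairs of a point of \<open>N\<close> and a point outside \<open>N\<close> that are collinear
  with a fixed \<open>c \<in> N\<close> shows that every line through \<open>c\<close> is of this kind, so that
  the complement of \<open>N\<close> is closed under lines.\<close>

lemma restriction_iso_AG_imp_off_kernel:
  assumes r: "1 \<le> r" and N: "N \<subseteq> points (coord_space TYPE('f::{field,finite}) r)"
    and iso: "isomorphic (restriction (PG TYPE('f) r) N) (AG TYPE('f) r)"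
  shows "\<exists>a\<in>coord_space TYPE('f) r. a \<noteq> 0 \<and> points {v \<in> coord_space TYPE('f) r. dot r a v \<noteq> 0} \<subseteq> N"
proof -
  let ?V = "coord_space TYPE('f) r" and ?q = "CARD('f)"
  let ?P = "points ?V"
  define K where "K = ?P - N"
  \<comment> \<open>\<open>e\<close> represents the first coordinate, which makes the model
    \<open>AG\<close> a set off a kernel, so that \<open>card_line_off_kernel\<close> counts its
    lines.\<close>
  define e :: "nat \<Rightarrow> 'f" where "e = (\<lambda>i. if i = 0 then 1 else 0)"
  have e: "e \<in> ?V" "e \<noteq> 0" using r by (auto simp: e_def coord_space_def fun_eq_iff)
  have dot_e: "dot r e v = v 0" for v
  proof -
    have "dot r e v = (\<Sum>i<r. if i = 0 then v 0 else 0)"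
      unfolding dot_def e_def by (rule sum.cong) auto
    then show ?thesis using r by simp
  qed
  let ?A = "points {v \<in> ?V. dot r e v \<noteq> 0}"
  have AG: "AG TYPE('f) r = restriction (PG TYPE('f) r) ?A"
    by (simp add: AG_eq dot_e)
  have AV: "?A \<subseteq> ?P" by (rule points_mono) auto
  obtain f where f: "matroid_iso f (restriction (PG TYPE('f) r) N) (restriction (PG TYPE('f) r) ?A)"
    using iso unfolding AG isomorphic_def by blast
  have gr: "ground (restriction (PG TYPE('f) r) N) = N" "ground (restriction (PG TYPE('f) r) ?A) = ?A"
    using N AV by auto
  have bij: "bij_betw f N ?A" using f gr by (simp add: matroid_iso_def)
  have cardN: "?q * card N = ?q ^ r"
    using bij_betw_same_card[OF bij] card_points_off_kernel[OF e] by simp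
  have finP: "finite ?P" by (intro finite_points finite_coord_space)
  have finN: "finite N" and finK: "finite K"
    using N finP finite_subset by (auto simp: K_def)
  have q2: "2 \<le> ?q" by (rule card_field_ge_2)
  \<comment> \<open>Follows from \<open>q * card N = q ^ r\<close> and the number of all points.
    This exact value makes the double count below tight.\<close>
  have cardK: "card K * (?q - 1) = card N - 1"
  proof -
    have "card ?P * (?q - 1) = ?q ^ r - 1"
      using card_points_subspace[OF finite_coord_space subspace_coord_space[where ?'f = 'f], of r]
      by (simp add: dim_coord_space)
    moreover have "card ?P = card K + card N"
      using N finP finN card_Diff_subset[of N ?P] card_mono[of ?P N] by (simp add: K_def)
    ultimately have "card K * (?q - 1) + card N * (?q - 1) = ?q * card N - 1"
      using cardN by (simp add: add_mult_distrib)
    moreover have "card N * (?q - 1) + card N = ?q * card N"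
      using q2 by (cases ?q) (simp_all add: mult.commute)
    moreover have "card N \<noteq> 0" using cardN q2 by (intro notI) simp
    ultimately show ?thesis by linarith
  qed
  have line_N: "card (points (fvs.span (x \<union> y)) \<inter> N) = ?q" if xy: "x \<in> N" "y \<in> N" "x \<noteq> y" for x y
  proof -
    have f_mem: "f x \<in> ?A" "f y \<in> ?A" "f x \<noteq> f y"
      using bij xy by (auto simp: bij_betw_def inj_on_def)
    have f_memV: "f x \<in> ?P" "f y \<in> ?P" using f_mem AV by auto
    have xyV: "x \<in> ?P" "y \<in> ?P" using N xy by auto
    show ?thesis
      using card_line_iso[OF f, of x y] xy xyV gr f_mem card_line_off_kernel[OF f_mem]
      by (simp add: line_restriction line_PG[OF xyV xy(3)] line_PG[OF f_memV f_mem(3)])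
  qed
  have line_K: "card (points (fvs.span (x \<union> y)) \<inter> K) = 1" if xy: "x \<in> N" "y \<in> N" "x \<noteq> y" for x y
  proof -
    have xyV: "x \<in> ?P" "y \<in> ?P" using N xy by auto
    have sub: "points (fvs.span (x \<union> y)) \<subseteq> ?P"
      by (rule points_mono[OF span_two_points_subset[OF xyV xy(3)]])
    then have fin: "finite (points (fvs.span (x \<union> y)))" using finP finite_subset by blast
    have "points (fvs.span (x \<union> y)) = (points (fvs.span (x \<union> y)) \<inter> N) \<union> (points (fvs.span (x \<union> y)) \<inter> K)"
      using sub by (auto simp: K_def)
    then have "card (points (fvs.span (x \<union> y))) =
      card (points (fvs.span (x \<union> y)) \<inter> N) + card (points (fvs.span (x \<union> y)) \<inter> K)"
      using fin card_Un_disjoint[of "points (fvs.span (x \<union> y)) \<inter> N" "points (fvs.span (x \<union> y)) \<inter> K"]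
      by (simp add: K_def Int_Diff Int_assoc) blast
    then show ?thesis using card_points_line[OF xyV xy(3)] line_N[OF xy] by simp
  qed
  have "points (fvs.span (x \<union> y)) \<subseteq> K" if xy: "x \<in> K" "y \<in> K" "x \<noteq> y" for x y
  proof (rule ccontr)
    assume "\<not> points (fvs.span (x \<union> y)) \<subseteq> K"
    have xyV: "x \<in> ?P" "y \<in> ?P" using xy by (auto simp: K_def)
    obtain c where c: "c \<in> points (fvs.span (x \<union> y))" "c \<notin> K"
      using \<open>\<not> points (fvs.span (x \<union> y)) \<subseteq> K\<close> by blast
    have cV: "c \<in> ?P" using c(1) points_mono[OF span_two_points_subset[OF xyV xy(3)]] by blast
    then have cN: "c \<in> N" using c(2) by (simp add: K_def)
    let ?R = "\<lambda>u z. z \<in> points (fvs.span (c \<union> u))"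
    have R_line: "fvs.span (c \<union> z) = fvs.span (c \<union> u)" if "u \<in> N - {c}" "z \<in> K" "?R u z" for u z
      using that cN N by (intro line_exchange[of _ r]) (auto simp: K_def)
    have cx: "fvs.span (c \<union> x) = fvs.span (x \<union> y)"
      using line_exchange[OF xyV c(1) xy(3)] c xy by (auto simp: Un_commute)
    have le: "card {u \<in> N - {c}. ?R u z} \<le> ?q - 1" if z: "z \<in> K" for z
    proof (cases "{u \<in> N - {c}. ?R u z} = {}")
      case False
      then obtain u where u: "u \<in> N - {c}" "?R u z" by blast
      have "{u \<in> N - {c}. ?R u z} \<subseteq> points (fvs.span (c \<union> u)) \<inter> N - {c}"
      proof
        fix t assume t: "t \<in> {u \<in> N - {c}. ?R u z}"
        then have "fvs.span (c \<union> u) = fvs.span (c \<union> t)"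
          using R_line[OF u(1) z u(2)] R_line[OF _ z, of t] by simp
        then show "t \<in> points (fvs.span (c \<union> u)) \<inter> N - {c}"
          using t cN two_points_mem_span(2)[of c ?V t] N by auto
      qed
      then have "card {u \<in> N - {c}. ?R u z} \<le> card (points (fvs.span (c \<union> u)) \<inter> N - {c})"
        using finN by (intro card_mono) auto
      also have "\<dots> = ?q - 1"
      proof -
        have "u \<in> N" "c \<noteq> u" using u(1) by blast+
        moreover have "c \<in> points (fvs.span (c \<union> u))"
          using two_points_mem_span(1)[of c ?V u] cV N \<open>u \<in> N\<close> by blast
        ultimately show ?thesis using line_N[OF cN, of u] cN by simp
      qed
      finally show ?thesis .
    next
      case True
      then show ?thesis by (simp only: card.empty le0)
    qed
    \<comment> \<open>The line through \<open>c\<close> and \<open>x\<close> is the line through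
      \<open>x\<close> and \<open>y\<close>, which has two points of \<open>K\<close>; a second
      point of \<open>N\<close> on it would allow only one.\<close>
    have empty: "{u \<in> N - {c}. ?R u x} = {}"
    proof (rule ccontr)
      assume "{u \<in> N - {c}. ?R u x} \<noteq> {}"
      then obtain u where u: "u \<in> N - {c}" "?R u x" by blast
      then have "fvs.span (x \<union> y) = fvs.span (c \<union> u)" using R_line[OF u(1) xy(1) u(2)] cx by simp
      then have "card (points (fvs.span (x \<union> y)) \<inter> K) = 1" using line_K[OF cN, of u] u by auto
      moreover have "x \<in> points (fvs.span (x \<union> y)) \<inter> K" "y \<in> points (fvs.span (x \<union> y)) \<inter> K"
        using two_points_mem_span[OF xyV] xy by auto
      ultimately show False using xy(3) by (metis card_1_singletonE singletonD)
    qed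
    \<comment> \<open>Counted by \<open>u\<close>, there are \<open>card N - 1\<close> collinear
      pairs, one for each \<open>u\<close>. Counted by \<open>z\<close>, there are at most
      \<open>q - 1\<close> for each \<open>z\<close> and none for \<open>x\<close>, which is
      strictly fewer than \<open>card K * (q - 1) = card N - 1\<close>.\<close>
    have "(\<Sum>z\<in>K. card {u \<in> N - {c}. ?R u z}) < (\<Sum>z\<in>K. ?q - 1)"
    proof (rule sum_strict_mono_ex1[OF finK])
      have "card {u \<in> N - {c}. ?R u x} < ?q - 1" unfolding empty using q2 by simp
      then show "\<exists>z\<in>K. card {u \<in> N - {c}. ?R u z} < ?q - 1" using xy(1) by blast
    qed (use le in blast)
    also have "\<dots> = card N - 1" using cardK by simp
    also have "\<dots> = card (N - {c})" using cN by simp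
    also have "\<dots> = (\<Sum>u\<in>N - {c}. card {z \<in> K. ?R u z})"
    proof -
      have "card {z \<in> K. ?R u z} = 1" if "u \<in> N - {c}" for u
        using line_K[OF cN, of u] that by (auto simp: Int_def conj_commute)
      then show ?thesis by simp
    qed
    also have "\<dots> = (\<Sum>z\<in>K. card {u \<in> N - {c}. ?R u z})"
      using sum.swap_restrict[of "N - {c}" K "\<lambda>_ _. 1::nat" ?R] finN finK by simp
    finally show False by simp
  qed
  then obtain U where U: "fvs.subspace U" "U \<subseteq> ?V" "K = points U"
    using line_closed_imp_subspace[of K r] by (auto simp: K_def)
  have finU: "finite U" using U(2) finite_coord_space finite_subset by blast
  have "?q ^ fvs.dim U - 1 = card N - 1"
    using card_points_subspace[OF finU U(1)] cardK U(3) by simp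
  moreover have "0 < card N" using cardN q2 by (intro gr0I) simp
  ultimately have "?q ^ fvs.dim U = card N" using q2 by (simp add: eq_diff_iff Suc_le_eq)
  then have "?q ^ Suc (fvs.dim U) = ?q ^ r" using cardN by simp
  then have "fvs.dim U < r" using q2 by (simp add: power_inject_exp del: power_Suc)
  then obtain a where a: "a \<in> ?V" "a \<noteq> 0" "\<And>u. u \<in> U \<Longrightarrow> dot r a u = 0"
    using ex_annihilator[OF finU] by blast
  have "points {v \<in> ?V. dot r a v \<noteq> 0} \<subseteq> N"
  proof
    fix p assume p: "p \<in> points {v \<in> ?V. dot r a v \<noteq> 0}"
    then obtain v where v: "v \<in> ?V" "dot r a v \<noteq> 0" "v \<noteq> 0" "p = fvs.span {v}" by (auto elim: pointsE)
    then have "v \<notin> U" using a(3) by blast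
    then have "p \<notin> K" using v U(1,3) span_mem_points_iff subspace_imp_scale_closed by blast
    then show "p \<in> N" using v by (auto simp: K_def intro: pointsI)
  qed
  then show ?thesis using a by blast
qed

section \<open>Bases and cocircuits\<close>

lemma ex_circuit_subset:
  assumes "finite X" "X \<subseteq> ground N" "\<not> indep N X"
  shows "\<exists>C\<subseteq>X. circuit N C"
  using assms
proof (induction X rule: finite_psubset_induct)
  case (psubset X)
  show ?case
  proof (cases "\<forall>Y. Y \<subset> X \<longrightarrow> indep N Y")
    case True
    then show ?thesis using psubset.prems by (auto simp: circuit_def)
  next
    case False
    then obtain Y where "Y \<subset> X" "\<not> indep N Y" by blast
    then show ?thesis using psubset.IH[of Y] psubset.prems by blast
  qed
qed

context matroid
begin

lemma finite_indep: "indep M X \<Longrightarrow> finite X"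
  using finite_ground indep_subset_ground finite_subset by blast

lemma finite_card_indep: "finite (card ` {X. indep M X})"
  by (rule finite_imageI, rule finite_subset[of _ "Pow (ground M)"])
    (auto simp: finite_ground dest: indep_subset_ground)

lemma card_indep_le_rank: "indep M X \<Longrightarrow> card X \<le> rank M"
  unfolding rank_def by (rule Max_ge[OF finite_card_indep]) auto

lemma ex_indep_card_rank: "\<exists>X. indep M X \<and> card X = rank M"
proof -
  have "rank M \<in> card ` {X. indep M X}"
    unfolding rank_def using indep_empty by (intro Max_in finite_card_indep) auto
  then show ?thesis by auto
qed

lemma card_basis:
  assumes "basis M B"
  shows "card B = rank M"
proof -
  have B: "indep M B" using assms by (simp add: basis_def)
  have False if "card B < rank M"
  proof -
    obtain X where "indep M X" "card X = rank M" using ex_indep_card_rank by blast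
    then obtain y where "y \<in> X - B" "indep M (insert y B)"
      using augmentation[OF B, of X] \<open>card B < rank M\<close> by auto
    then show False using assms by (auto simp: basis_def)
  qed
  then show ?thesis using card_indep_le_rank[OF B] by force
qed

lemma basisI:
  assumes "indep M B" "card B = rank M"
  shows "basis M B"
  unfolding basis_def
proof (intro conjI allI impI)
  fix X assume "indep M X" "B \<subseteq> X"
  then show "X = B"
    using assms(2) card_indep_le_rank[of X] card_seteq[OF finite_indep[of X], of B] by simp
qed (rule assms(1))

lemma ex_basis: "\<exists>B. basis M B"
  using ex_indep_card_rank basisI by blast

lemma finite_cocircuits: "finite {C. cocircuit M C}"
  by (rule finite_subset[of _ "Pow (ground M)"])
    (auto simp: finite_ground cocircuit_def circuit_def dual_def)

text \<open>A subset of the ground set is dependent in the dual exactly when it meets every basis,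
  so cocircuits are the minimal sets that do.\<close>

lemma cocircuit_meets_basis: "cocircuit M C \<Longrightarrow> basis M B \<Longrightarrow> B \<inter> C \<noteq> {}"
  by (auto simp: cocircuit_def circuit_def dual_def)

lemma ex_cocircuit_subset:
  assumes "X \<subseteq> ground M" "\<And>B. basis M B \<Longrightarrow> B \<inter> X \<noteq> {}"
  shows "\<exists>C\<subseteq>X. cocircuit M C"
  unfolding cocircuit_def
  using assms finite_subset[OF assms(1) finite_ground]
  by (intro ex_circuit_subset) (auto simp: dual_def)

end

section \<open>Representable matroids embed into projective space\<close>

lemma simple_matroid_indep:
  assumes "simple_matroid M" "X \<subseteq> ground M" "card X \<le> 2"
  shows "indep M X"
proof (rule ccontr)
  assume "\<not> indep M X"
  have "matroid M" using assms(1) by (simp add: simple_matroid_def)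
  then have "finite X" using assms(2) matroid.finite_ground finite_subset by blast
  then obtain C where "C \<subseteq> X" "circuit M C"
    using ex_circuit_subset[OF _ assms(2) \<open>\<not> indep M X\<close>] by blast
  moreover have "card C \<le> card X" by (rule card_mono[OF \<open>finite X\<close> \<open>C \<subseteq> X\<close>])
  ultimately show False using assms(1,3) by (auto simp: simple_matroid_def)
qed

text \<open>One rank equation captures both conditions, because the dimension is at most the size of
  the image, which is at most the size of \<open>X\<close>.\<close>

lemma independent_image_iff_dim:
  fixes f :: "'a \<Rightarrow> nat \<Rightarrow> 'f::field"
  assumes "finite X"
  shows "inj_on f X \<and> fvs.independent (f ` X) \<longleftrightarrow> fvs.dim (f ` X) = card X"
proof
  assume *: "fvs.dim (f ` X) = card X"
  have "fvs.dim (f ` X) \<le> card (f ` X)"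
    by (rule fvs.dim_le_card) (simp_all add: assms fvs.span_superset)
  then have "card (f ` X) = card X"
    using * card_image_le[OF assms, of f] by simp
  then show "inj_on f X \<and> fvs.independent (f ` X)"
    using * assms by (simp add: eq_card_imp_inj_on independent_iff_dim)
qed (auto simp: assms independent_iff_dim card_image)

text \<open>The number of rows of a representing matrix is arbitrary, but its columns span a space
  of dimension \<open>rank M\<close>, which is identified with the \<open>r\<close>-dimensional
  coordinate space. Simplicity makes the columns nonzero and pairwise non-proportional, so they give
  distinct points.\<close>

lemma representable_embedding:
  assumes simple: "simple_matroid M" and rep: "representable TYPE('f::{field,finite}) M"
    and rank: "rank M = r"
  shows "\<exists>e. matroid_embedding e M (PG TYPE('f) r)"
proof -
  interpret matroid M using simple by (simp add: simple_matroid_def)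
  obtain n and f :: "'a \<Rightarrow> nat \<Rightarrow> 'f" where f: "f ` ground M \<subseteq> coord_space TYPE('f) n"
    and ind: "\<And>X. X \<subseteq> ground M \<Longrightarrow> indep M X \<longleftrightarrow> inj_on f X \<and> fvs.independent (f ` X)"
    using rep unfolding representable_def by blast
  have finX: "finite X" if "X \<subseteq> ground M" for X using that finite_ground finite_subset by blast
  have indep_dim: "indep M X \<longleftrightarrow> fvs.dim (f ` X) = card X" if "X \<subseteq> ground M" for X
    using ind[OF that] independent_image_iff_dim[OF finX[OF that]] by blast
  have dim: "fvs.dim (f ` ground M) = r"
  proof (rule antisym)
    obtain B where B: "B \<subseteq> f ` ground M" "fvs.independent B" "f ` ground M \<subseteq> fvs.span B"
      "card B = fvs.dim (f ` ground M)"
      using fvs.basis_exists by blast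
    obtain X where X: "X \<subseteq> ground M" "inj_on f X" "f ` X = B"
      using B(1) by (metis subset_image_inj)
    then have "indep M X" using ind B(2) by blast
    then have "card X \<le> r" using card_indep_le_rank rank by simp
    then show "fvs.dim (f ` ground M) \<le> r" using B(4) X card_image by metis
  next
    obtain X where X: "indep M X" "card X = r" using ex_indep_card_rank rank by blast
    then have "X \<subseteq> ground M" using indep_subset_ground by blast
    then have "f ` X \<subseteq> fvs.span (f ` ground M)"
      by (intro subset_trans[OF image_mono fvs.span_superset])
    then have "fvs.dim (f ` X) \<le> fvs.dim (f ` ground M)"
      by (intro dim_mono finite_imageI finite_ground)
    then show "r \<le> fvs.dim (f ` ground M)"
      using X indep_dim[OF \<open>X \<subseteq> ground M\<close>] by simp
  qed
  obtain T where T: "module_hom fscale fscale T" "inj_on T (coord_space TYPE('f) r)"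
    "T ` coord_space TYPE('f) r = fvs.span (f ` ground M)"
    using linear_iso_coord_space[of "f ` ground M"] finite_ground dim by auto
  define g where "g = (\<lambda>x. inv_into (coord_space TYPE('f) r) T (f x))"
  have g: "g x \<in> coord_space TYPE('f) r" "T (g x) = f x" if "x \<in> ground M" for x
  proof -
    have "f x \<in> T ` coord_space TYPE('f) r" using that T(3) by (simp add: fvs.span_base)
    then show "g x \<in> coord_space TYPE('f) r" "T (g x) = f x"
      unfolding g_def by (rule inv_into_into, rule f_inv_into_f)
  qed
  define e where "e = (\<lambda>x. fvs.span {g x})"
  have dim_e: "fvs.dim (\<Union>(e ` X)) = fvs.dim (f ` X)" if X: "X \<subseteq> ground M" for X
  proof -
    have "e ` X = (\<lambda>v. fvs.span {v}) ` g ` X" by (auto simp: e_def)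
    then have "fvs.dim (\<Union>(e ` X)) = fvs.dim (g ` X)" by (simp only: dim_Union_points)
    also have "\<dots> = fvs.dim (T ` g ` X)"
    proof (rule dim_linear_image[OF _ T(1), symmetric])
      show "finite (g ` X)" using finX[OF X] by simp
      have "fvs.span (g ` X) \<subseteq> coord_space TYPE('f) r"
        using g(1) X by (intro fvs.span_minimal subspace_coord_space) blast
      then show "inj_on T (fvs.span (g ` X))" by (rule inj_on_subset[OF T(2)])
    qed
    also have "T ` g ` X = f ` X" using g(2) X by force
    finally show ?thesis .
  qed
  have "g x \<noteq> 0" if x: "x \<in> ground M" for x
  proof -
    have "indep M {x}" using x by (intro simple_matroid_indep[OF simple]) auto
    then have "f x \<noteq> 0" using ind[of "{x}"] x by simp
    then show ?thesis using g(2)[OF x] module_hom.zero[OF T(1)] by metis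
  qed
  then have e_mem: "e x \<in> points (coord_space TYPE('f) r)" if "x \<in> ground M" for x
    unfolding e_def using g(1) that by (blast intro: pointsI)
  have e_inj: "inj_on e (ground M)"
  proof (rule inj_onI, rule ccontr)
    fix x y assume xy: "x \<in> ground M" "y \<in> ground M" "e x = e y" "x \<noteq> y"
    have "indep M {x, y}" "indep M {x}"
      using xy by (intro simple_matroid_indep[OF simple]; simp)+
    then have "fvs.dim (\<Union>(e ` {x, y})) = 2" "fvs.dim (\<Union>(e ` {x})) = 1"
      using xy indep_dim[of "{x, y}"] indep_dim[of "{x}"] dim_e[of "{x, y}"] dim_e[of "{x}"] by auto
    then show False using xy(3) by simp
  qed
  have "indep M X \<longleftrightarrow> indep (restriction (PG TYPE('f) r) (e ` ground M)) (e ` X)"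
    if X: "X \<subseteq> ground M" for X
  proof -
    have "card (e ` X) = card X" using e_inj X by (meson card_image inj_on_subset)
    moreover have "e ` X \<subseteq> points (coord_space TYPE('f) r)" using e_mem X by blast
    ultimately show ?thesis
      using indep_dim[OF X] dim_e[OF X] X by (auto simp: indep_PG)
  qed
  moreover have sub: "e ` ground M \<subseteq> points (coord_space TYPE('f) r)" using e_mem by blast
  ultimately have "matroid_embedding e M (PG TYPE('f) r)"
    using e_inj by (simp add: matroid_embedding_def matroid_iso_def bij_betw_def Int_absorb1)
  then show ?thesis by blast
qed

section \<open>Weighted restrictions of projective space\<close>

locale pg_restriction = matroid M for M :: "'a set_system" +
  fixes e :: "'a \<Rightarrow> (nat \<Rightarrow> 'f::{field,finite}) set" and r :: nat
  assumes rank: "rank M = r" and embedding: "matroid_embedding e M (PG TYPE('f) r)"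
begin

abbreviation "V \<equiv> coord_space TYPE('f) r"
abbreviation "E \<equiv> ground M"

definition off :: "(nat \<Rightarrow> 'f) \<Rightarrow> 'a set" where
  "off a = {x \<in> E. e x \<in> points {v \<in> V. dot r a v \<noteq> 0}}"

lemma e_mem: "x \<in> E \<Longrightarrow> e x \<in> points V"
  using embedding by (auto simp: matroid_embedding_def)

lemma e_inj: "inj_on e E"
  using embedding by (simp add: matroid_embedding_def matroid_iso_def bij_betw_def)

lemma indep_e: "X \<subseteq> E \<Longrightarrow> indep M X \<longleftrightarrow> indep (PG TYPE('f) r) (e ` X)"
  using embedding by (auto simp: matroid_embedding_def matroid_iso_def)

lemma indep_iff:
  assumes "X \<subseteq> E"
  shows "indep M X \<longleftrightarrow> fvs.dim (\<Union>(e ` X)) = card X"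
proof -
  have "card (e ` X) = card X" using e_inj assms by (meson card_image inj_on_subset)
  moreover have "e ` X \<subseteq> points V" using assms e_mem by blast
  ultimately show ?thesis using indep_e[OF assms] by (simp add: indep_PG)
qed

lemma restriction_iso: "X \<subseteq> E \<Longrightarrow> isomorphic (restriction M X) (restriction (PG TYPE('f) r) (e ` X))"
  unfolding isomorphic_def matroid_iso_def
proof (intro exI[of _ e] conjI allI impI)
  assume X: "X \<subseteq> E"
  show "bij_betw e (ground (restriction M X)) (ground (restriction (PG TYPE('f) r) (e ` X)))"
    using X e_mem inj_on_subset[OF e_inj X] by (auto simp: bij_betw_def Int_absorb1)
  fix Y assume "Y \<subseteq> ground (restriction M X)"
  then have "Y \<subseteq> X" "Y \<subseteq> E" by auto
  then show "indep (restriction M X) Y \<longleftrightarrow> indep (restriction (PG TYPE('f) r) (e ` X)) (e ` Y)"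
    using indep_e by auto
qed

lemma ex_missing_point:
  assumes "\<not> isomorphic M (PG TYPE('f) r)"
  shows "\<exists>p\<in>V. p \<noteq> 0 \<and> fvs.span {p} \<notin> e ` E"
proof (rule ccontr)
  assume "\<not> ?thesis"
  then have "points V \<subseteq> e ` E" by (auto elim!: pointsE)
  then have eq: "e ` E = points V" using e_mem by auto
  have "matroid_iso e M (PG TYPE('f) r)"
    using embedding unfolding matroid_embedding_def eq by (simp only: restriction_PG_all)
  then show False using assms by (auto simp: isomorphic_def)
qed

lemma Union_e:
  assumes "X \<subseteq> E"
  shows "\<Union>(e ` X) \<subseteq> V" "finite (\<Union>(e ` X))"
proof -
  show "\<Union>(e ` X) \<subseteq> V"
    using Union_points_subset[OF subspace_coord_space, of "e ` X" r] e_mem assms by blast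
  then show "finite (\<Union>(e ` X))" by (rule finite_subset[OF _ finite_coord_space])
qed

lemma not_off_imp_kernel:
  assumes "x \<in> E" "x \<notin> off a" "v \<in> e x"
  shows "dot r a v = 0"
proof (cases "v = 0")
  case False
  have "v \<in> V" using Union_e(1)[of "{x}"] assms by auto
  moreover have "e x = fvs.span {v}" using point_eq_span[OF e_mem[OF assms(1)] assms(3) False] .
  ultimately show ?thesis using assms(1,2) False by (auto simp: off_def intro: pointsI)
qed simp

text \<open>Since \<open>M\<close> has full rank \<open>r\<close>, the points of a basis span
  \<open>V\<close> and cannot all lie on a hyperplane.\<close>

lemma off_meets_basis:
  assumes a: "a \<in> V" "a \<noteq> 0" and B: "basis M B"
  shows "B \<inter> off a \<noteq> {}"
proof
  assume "B \<inter> off a = {}"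
  have "indep M B" using B by (simp add: basis_def)
  then have BE: "B \<subseteq> E" by (rule indep_subset_ground)
  have "fvs.dim (\<Union>(e ` B)) = r"
    using indep_iff[OF BE] \<open>indep M B\<close> card_basis[OF B] rank by simp
  moreover have "fvs.span (\<Union>(e ` B)) \<subseteq> V"
    by (rule fvs.span_minimal[OF Union_e(1)[OF BE] subspace_coord_space])
  ultimately have "fvs.span (\<Union>(e ` B)) = V"
    by (intro subspace_eqI_dim finite_coord_space subspace_coord_space) (simp_all add: dim_coord_space)
  moreover have "fvs.span (\<Union>(e ` B)) \<subseteq> {v \<in> V. dot r a v = 0}"
    using BE \<open>B \<inter> off a = {}\<close> Union_e(1)[OF BE] not_off_imp_kernel
    by (intro fvs.span_minimal subspace_dot_kernel) blast
  ultimately show False using dot_eq_1'[OF a] by force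
qed

text \<open>Together with the next lemma this sandwiches cocircuits and hyperplane complements. As
  weights are positive, their minimum weights agree, and no exact correspondence has to be
  proved.\<close>

lemma off_supset_cocircuit:
  assumes "a \<in> V" "a \<noteq> 0"
  shows "\<exists>C\<subseteq>off a. cocircuit M C"
proof (rule ex_cocircuit_subset)
  show "off a \<subseteq> E" by (auto simp: off_def)
qed (rule off_meets_basis[OF assms])

text \<open>The elements outside a cocircuit cannot span \<open>V\<close>, as otherwise a basis
  would avoid it; hence some nonzero form kills all of them.\<close>

lemma cocircuit_supset_off:
  assumes C: "cocircuit M C"
  shows "\<exists>a\<in>V. a \<noteq> 0 \<and> off a \<subseteq> C"
proof -
  let ?S = "\<Union>(e ` (E - C))"
  have S: "?S \<subseteq> V" "finite ?S" by (rule Union_e; blast)+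
  have "fvs.dim ?S < r"
  proof (rule ccontr)
    assume *: "\<not> fvs.dim ?S < r"
    obtain B where B: "B \<subseteq> ?S" "fvs.independent B" "?S \<subseteq> fvs.span B" "card B = fvs.dim ?S"
      using fvs.basis_exists by blast
    have "\<forall>b\<in>B. \<exists>x. x \<in> E - C \<and> b \<in> e x" using B(1) by blast
    \<comment> \<open>\<open>h\<close> selects for each vector of \<open>B\<close> an element
      outside \<open>C\<close> whose point contains it. The bounds on dimension and size then force
      the selected elements to be independent and \<open>r\<close> in number, hence a basis.\<close>
    then obtain h where h: "\<And>b. b \<in> B \<Longrightarrow> h b \<in> E - C \<and> b \<in> e (h b)" by metis
    have finB: "finite B" by (rule finite_subset[OF B(1) S(2)])
    have hB: "h ` B \<subseteq> E" "h ` B \<inter> C = {}" using h by blast+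
    have fin: "finite (\<Union>(e ` h ` B))" by (rule Union_e(2)[OF hB(1)])
    have "B \<subseteq> \<Union>(e ` h ` B)" using h by blast
    then have "B \<subseteq> fvs.span (\<Union>(e ` h ` B))" by (rule subset_trans[OF _ fvs.span_superset])
    then have "card B \<le> fvs.dim (\<Union>(e ` h ` B))"
      using dim_mono[OF fin, of B] fvs.dim_eq_card_independent[OF B(2)] by simp
    moreover have "fvs.dim (\<Union>(e ` h ` B)) \<le> card (h ` B)"
    proof -
      have "\<exists>v. e x = fvs.span {v}" if "x \<in> E" for x
        using e_mem[OF that] by (rule pointsE) blast
      then have "\<forall>x\<in>h ` B. \<exists>v. e x = fvs.span {v}" using hB(1) by blast
      then obtain v where v: "\<And>x. x \<in> h ` B \<Longrightarrow> e x = fvs.span {v x}" by metis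
      then have "e ` h ` B = (\<lambda>u. fvs.span {u}) ` v ` h ` B" by (auto simp: image_image)
      then have "fvs.dim (\<Union>(e ` h ` B)) = fvs.dim (v ` h ` B)" by (simp only: dim_Union_points)
      also have "\<dots> \<le> card (v ` h ` B)"
        using finB by (intro fvs.dim_le_card fvs.span_superset) simp
      also have "\<dots> \<le> card (h ` B)" using finB by (intro card_image_le) simp
      finally show ?thesis .
    qed
    moreover have "card (h ` B) \<le> card B" by (rule card_image_le[OF finB])
    ultimately have "fvs.dim (\<Union>(e ` h ` B)) = card (h ` B)" and card: "card (h ` B) = card B"
      by simp_all
    then have "indep M (h ` B)" using indep_iff[OF hB(1)] by simp
    moreover have "card (h ` B) = r"
      using card_indep_le_rank[OF calculation] rank card B(4) * by simp
    ultimately have "basis M (h ` B)" using basisI rank by simp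
    then show False using cocircuit_meets_basis[OF C] hB(2) by blast
  qed
  then obtain a where a: "a \<in> V" "a \<noteq> 0" "\<And>u. u \<in> ?S \<Longrightarrow> dot r a u = 0"
    using ex_annihilator[OF S(2)] by blast
  have "off a \<subseteq> C"
  proof
    fix x assume "x \<in> off a"
    then obtain v where v: "x \<in> E" "e x = fvs.span {v}" "dot r a v \<noteq> 0"
      by (auto simp: off_def elim: pointsE)
    then show "x \<in> C" using a(3)[of v] fvs.span_base[of v "{v}"] by blast
  qed
  then show ?thesis using a by blast
qed

end

section \<open>Transferring the weight to vectors\<close>

locale weighted_pg_restriction = pg_restriction M e r
  for M :: "'a set_system" and e :: "'a \<Rightarrow> (nat \<Rightarrow> 'f::{field,finite}) set" and r :: nat +
  fixes w :: "'a \<Rightarrow> int" and q :: int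
  assumes weight: "weight_function M w"
    and proper: "\<not> isomorphic M (PG TYPE('f) r)"
    and q_eq: "q = int CARD('f)"
begin

lemma q_ge_2: "2 \<le> q"
  using card_field_ge_2[where ?'f = 'f] unfolding q_eq by linarith

lemma weight_pos: "x \<in> E \<Longrightarrow> 0 < w x"
  using weight by (simp add: weight_function_def)

lemma sum_weight_mono: "X \<subseteq> Y \<Longrightarrow> Y \<subseteq> E \<Longrightarrow> sum w X \<le> sum w Y"
  using finite_ground finite_subset by (intro sum_mono2) (auto simp: weight_pos less_imp_le)

lemma off_subset: "off a \<subseteq> E"
  by (auto simp: off_def)

lemma cogirth_le_off:
  assumes "a \<in> V" "a \<noteq> 0"
  shows "cogirth M w \<le> sum w (off a)"
proof -
  obtain C where C: "C \<subseteq> off a" "cocircuit M C" using off_supset_cocircuit[OF assms] by blast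
  have "cogirth M w \<le> sum w C"
    unfolding cogirth_def using C(2) finite_cocircuits by (intro Min_le) auto
  also have "\<dots> \<le> sum w (off a)" by (rule sum_weight_mono[OF C(1) off_subset])
  finally show ?thesis .
qed

lemma ex_nonzero: "\<exists>a\<in>V. a \<noteq> 0"
  using ex_missing_point[OF proper] by blast

lemma ex_off_le_cogirth: "\<exists>a\<in>V. a \<noteq> 0 \<and> sum w (off a) \<le> cogirth M w"
proof -
  have "cogirth M w \<in> sum w ` {C. cocircuit M C}"
    unfolding cogirth_def using ex_nonzero off_supset_cocircuit finite_cocircuits
    by (intro Min_in) auto
  then obtain C where C: "cocircuit M C" "cogirth M w = sum w C" by blast
  then obtain a where "a \<in> V" "a \<noteq> 0" "off a \<subseteq> C" using cocircuit_supset_off by blast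
  moreover have "C \<subseteq> E" using C(1) by (simp add: cocircuit_def circuit_def dual_def)
  ultimately show ?thesis using C(2) sum_weight_mono by metis
qed

lemma cogirth_pos: "0 < cogirth M w"
proof -
  obtain a where a: "a \<in> V" "a \<noteq> 0" "sum w (off a) \<le> cogirth M w" using ex_off_le_cogirth by blast
  have "off a \<noteq> {}" using off_meets_basis[OF a(1,2)] ex_basis by blast
  then have "0 < sum w (off a)"
    using off_subset[of a] finite_subset[OF off_subset finite_ground] weight_pos
    by (intro sum_pos) auto
  then show ?thesis using a(3) by simp
qed

text \<open>At most one summand is nonzero, since distinct points meet only in \<open>0\<close>. The
  sum supplies the value zero off \<open>M\<close> and lets the order of summation be
  swapped.\<close>

definition W :: "(nat \<Rightarrow> 'f) \<Rightarrow> int" where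
  "W v = (\<Sum>x\<in>E. if v \<in> e x \<and> v \<noteq> 0 then w x else 0)"

lemma W_eq:
  assumes "x \<in> E" "v \<in> e x" "v \<noteq> 0"
  shows "W v = w x"
proof -
  have unique: "y = x" if "y \<in> E" "v \<in> e y" for y
    using point_eq_span[OF e_mem[OF that(1)] that(2) assms(3)]
      point_eq_span[OF e_mem[OF assms(1)] assms(2,3)]
    by (intro inj_onD[OF e_inj _ that(1) assms(1)]) simp
  have "W v = (\<Sum>y\<in>E. if y = x then w x else 0)"
    unfolding W_def
  proof (rule sum.cong[OF refl])
    fix y assume "y \<in> E"
    then show "(if v \<in> e y \<and> v \<noteq> 0 then w y else 0) = (if y = x then w x else 0)"
    proof (cases "y = x")
      case False
      then have "v \<notin> e y" using unique \<open>y \<in> E\<close> by blast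
      then show ?thesis using False by simp
    qed (use assms in simp)
  qed
  then show ?thesis using assms(1) finite_ground by simp
qed

lemma W_eq_0_iff: "W v = 0 \<longleftrightarrow> v = 0 \<or> (\<forall>x\<in>E. v \<notin> e x)"
proof
  assume "W v = 0"
  then show "v = 0 \<or> (\<forall>x\<in>E. v \<notin> e x)" using W_eq weight_pos by fastforce
qed (auto simp: W_def intro!: sum.neutral)

lemma W_eq_0_iff_span:
  assumes "v \<noteq> 0"
  shows "W v = 0 \<longleftrightarrow> fvs.span {v} \<notin> e ` E"
proof -
  have "v \<in> e x \<longleftrightarrow> fvs.span {v} = e x" if "x \<in> E" for x
    using point_eq_span[OF e_mem[OF that] _ assms] fvs.span_base[of v "{v}"] by auto
  then show ?thesis using assms by (auto simp: W_eq_0_iff)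
qed

lemma W_scale:
  assumes "c \<noteq> 0"
  shows "W (fscale c v) = W v"
proof -
  have "fscale c v \<in> e x \<longleftrightarrow> v \<in> e x" if x: "x \<in> E" for x
  proof -
    obtain u where u: "e x = fvs.span {u}" using e_mem[OF x] by (auto elim: pointsE)
    have "fscale (inverse c) (fscale c v) = v" using assms by simp
    then show ?thesis unfolding u using fvs.span_scale by metis
  qed
  then show ?thesis unfolding W_def using assms by (intro sum.cong) auto
qed

text \<open>A scale-closed set contains all \<open>q - 1\<close> nonzero vectors of a point or none
  of them.\<close>

lemma sum_W:
  assumes "Z \<subseteq> V" "scale_closed Z"
  shows "(\<Sum>v\<in>Z. W v) = (q - 1) * (\<Sum>x | x \<in> E \<and> e x \<in> points Z. w x)"
proof -
  have finZ: "finite Z" by (rule finite_subset[OF assms(1) finite_coord_space])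
  have "(\<Sum>v\<in>Z. if v \<in> e x \<and> v \<noteq> 0 then w x else 0) =
    (if e x \<in> points Z then (q - 1) * w x else 0)" if x: "x \<in> E" for x
  proof -
    obtain u where u: "u \<noteq> 0" "e x = fvs.span {u}" using e_mem[OF x] by (auto elim: pointsE)
    have mem: "v \<in> Z \<longleftrightarrow> e x \<in> points Z" if "v \<in> e x" "v \<noteq> 0" for v
      using span_mem_points_iff[OF assms(2) that(2)] point_eq_span[OF e_mem[OF x] that] by simp
    have "{v \<in> Z. v \<in> e x \<and> v \<noteq> 0} = (if e x \<in> points Z then fvs.span {u} - {0} else {})"
      using mem u(2) by auto
    then have "int (card {v \<in> Z. v \<in> e x \<and> v \<noteq> 0}) = (if e x \<in> points Z then q - 1 else 0)"
      using card_point_nonzero[OF u(1)] card_field_ge_2[where ?'f = 'f] by (simp add: of_nat_diff q_eq)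
    then have "(\<Sum>v\<in>{v \<in> Z. v \<in> e x \<and> v \<noteq> 0}. w x) = (if e x \<in> points Z then (q - 1) * w x else 0)"
      by simp
    then show ?thesis unfolding sum.inter_filter[OF finZ] .
  qed
  then have "(\<Sum>x\<in>E. \<Sum>v\<in>Z. if v \<in> e x \<and> v \<noteq> 0 then w x else 0) =
    (\<Sum>x\<in>E. if e x \<in> points Z then (q - 1) * w x else 0)"
    by (intro sum.cong) auto
  also have "\<dots> = (\<Sum>x | x \<in> E \<and> e x \<in> points Z. (q - 1) * w x)"
    by (rule sum.inter_filter[OF finite_ground, symmetric])
  finally show ?thesis
    unfolding W_def by (subst sum.swap) (simp add: sum_distrib_left)
qed

lemma sum_W_total: "(\<Sum>v\<in>V. W v) = (q - 1) * sum w E"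
proof -
  have "{x. x \<in> E \<and> e x \<in> points V} = E" using e_mem by auto
  then show ?thesis
    using sum_W[OF subset_refl subspace_imp_scale_closed[OF subspace_coord_space]] by simp
qed

lemma sum_W_kernel: "(\<Sum>v | v \<in> V \<and> dot r a v = 0. W v) = (q - 1) * (sum w E - sum w (off a))"
proof -
  have "(\<Sum>v\<in>V. W v) = (\<Sum>v\<in>{v \<in> V. dot r a v = 0} \<union> {v \<in> V. dot r a v \<noteq> 0}. W v)"
    by (rule sum.cong) auto
  also have "\<dots> = (\<Sum>v | v \<in> V \<and> dot r a v = 0. W v) + (\<Sum>v | v \<in> V \<and> dot r a v \<noteq> 0. W v)"
    by (rule sum.union_disjoint) (auto simp: finite_coord_space)
  also have "(\<Sum>v | v \<in> V \<and> dot r a v \<noteq> 0. W v) = (q - 1) * sum w (off a)"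
    unfolding off_def by (rule sum_W[OF _ scale_closed_off_kernel]) auto
  finally show ?thesis using sum_W_total by (simp add: algebra_simps)
qed

section \<open>Averaging over hyperplanes\<close>

text \<open>The outer factor counts the nonzero vectors of a point. The inner difference is
  nonnegative exactly when the complement of the hyperplane has at most \<open>(q-1)/q\<close> of
  the total weight.\<close>

lemma hyperplane_excess:
  "q * (\<Sum>v | v \<in> V \<and> dot r a v = 0. W v) - (\<Sum>v\<in>V. W v) =
    (q - 1) * ((q - 1) * sum w E - q * sum w (off a))"
  unfolding sum_W_total sum_W_kernel by (simp add: algebra_simps)

lemma W_zero_on_span:
  assumes "p \<in> V" "p \<noteq> 0" "W p = 0" "v \<in> fvs.span {p}"
  shows "W v = 0"
proof (cases "v = 0")
  case False
  then obtain c where "c \<noteq> 0" "v = fscale c p" using mem_span_singletonE[OF assms(4)] by blast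
  then show ?thesis using W_scale assms(3) by simp
qed (simp add: W_eq_0_iff)

lemma sum_hyperplane_excess:
  assumes "p \<in> V" "p \<noteq> 0" "W p = 0"
  shows "(\<Sum>a | a \<in> V \<and> dot r a p \<noteq> 0. (q - 1) * sum w E - q * sum w (off a)) = 0"
  using sum_kernel_sums_off_point[of p r W, OF assms(1), folded q_eq] W_zero_on_span[OF assms] q_ge_2
  unfolding hyperplane_excess by (simp flip: sum_distrib_left)

lemma ex_missing_vector: "\<exists>p\<in>V. p \<noteq> 0 \<and> W p = 0"
  using ex_missing_point[OF proper] W_eq_0_iff_span by blast

text \<open>The excesses sum to zero over the forms not killing a missing \<open>p\<close>, so one
  of them is nonnegative, and its complement bounds the cogirth.\<close>

lemma cogirth_bound: "q * cogirth M w \<le> (q - 1) * sum w E"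
proof -
  obtain p where p: "p \<in> V" "p \<noteq> 0" "W p = 0" using ex_missing_vector by blast
  let ?A = "{a \<in> V. dot r a p \<noteq> 0}"
  have "\<exists>a\<in>?A. 0 \<le> (q - 1) * sum w E - q * sum w (off a)"
  proof (rule ccontr)
    assume "\<not> ?thesis"
    moreover have "?A \<noteq> {}" using dot_eq_1[OF p(1,2)] by force
    ultimately have "(\<Sum>a\<in>?A. (q - 1) * sum w E - q * sum w (off a)) < (\<Sum>a\<in>?A. 0)"
      by (intro sum_strict_mono) (auto simp: finite_coord_space)
    then show False using sum_hyperplane_excess[OF p] by simp
  qed
  then obtain a where a: "a \<in> V" "dot r a p \<noteq> 0" "q * sum w (off a) \<le> (q - 1) * sum w E" by auto
  have "a \<noteq> 0" using a(2) by auto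
  then have "q * cogirth M w \<le> q * sum w (off a)"
    using cogirth_le_off[OF a(1)] q_ge_2 by simp
  then show ?thesis using a(3) by simp
qed

text \<open>Under equality every complement weighs at least the average, so the terms of a vanishing
  sum all have one sign and are zero. The sign is reversed in \<open>?x\<close> to make them
  nonnegative.\<close>

lemma translation_invariant:
  assumes eq: "q * cogirth M w = (q - 1) * sum w E"
    and p: "p \<in> V" "W p = 0" and v: "v \<in> V"
  shows "W (v + p) = W v"
proof (cases "p = 0")
  case False
  let ?A = "{a \<in> V. dot r a p \<noteq> 0}"
  let ?x = "\<lambda>a. q * sum w (off a) - (q - 1) * sum w E"
  have "0 \<le> ?x a" if "a \<in> ?A" for a
  proof -
    have "a \<in> V" "a \<noteq> 0" using that by auto
    then have "q * cogirth M w \<le> q * sum w (off a)" using cogirth_le_off q_ge_2 by simp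
    then show ?thesis using eq by simp
  qed
  moreover have "(\<Sum>a\<in>?A. ?x a) = 0"
  proof -
    have "(\<Sum>a\<in>?A. ?x a) = - (\<Sum>a\<in>?A. (q - 1) * sum w E - q * sum w (off a))"
      by (simp flip: sum_negf)
    then show ?thesis using sum_hyperplane_excess[OF p(1) False p(2)] by simp
  qed
  ultimately have "\<forall>a\<in>?A. ?x a = 0"
    by (subst (asm) sum_nonneg_eq_0_iff) (auto simp: finite_coord_space)
  then have "q * (\<Sum>v | v \<in> V \<and> dot r a v = 0. W v) = (\<Sum>v\<in>V. W v)"
    if "a \<in> V" "dot r a p \<noteq> 0" for a
    using hyperplane_excess[of a] that by auto
  then show ?thesis
    by (intro translation_invariant_if_hyperplane_sums[OF _ p(1) _ v, folded q_eq]) (simp_all add: W_scale)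
qed simp

lemma complement_eq: "points V - e ` E = points {v \<in> V. W v = 0}"
proof (intro equalityI subsetI)
  fix x assume x: "x \<in> points V - e ` E"
  then obtain v where "v \<in> V" "v \<noteq> 0" "x = fvs.span {v}" by (auto elim: pointsE)
  then show "x \<in> points {v \<in> V. W v = 0}" using x W_eq_0_iff_span by (auto intro: pointsI)
next
  fix x assume "x \<in> points {v \<in> V. W v = 0}"
  then obtain v where "v \<in> V" "W v = 0" "v \<noteq> 0" "x = fvs.span {v}" by (auto elim: pointsE)
  then show "x \<in> points V - e ` E" using W_eq_0_iff_span by (auto intro: pointsI)
qed

section \<open>Equality and the three conditions\<close>

definition extremal_structure :: "nat \<Rightarrow> bool" where
  "extremal_structure k \<longleftrightarrow> 1 \<le> k \<and> k < r \<and>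
    isomorphic (restriction (PG TYPE('f) r) (points V - e ` E)) (PG TYPE('f) k) \<and>
    (\<forall>P\<subseteq>points V. isomorphic (restriction (PG TYPE('f) r) P) (PG TYPE('f) (k + 1)) \<longrightarrow>
      points V - e ` E \<subseteq> P \<longrightarrow> (\<forall>x\<in>E. \<forall>y\<in>E. e x \<in> P \<longrightarrow> e y \<in> P \<longrightarrow> w x = w y)) \<and>
    (\<forall>N\<subseteq>E. isomorphic (restriction M N) (AG TYPE('f) r) \<longrightarrow> sum w N \<ge> (q - 1) * sum w (E - N))"

lemma point_vector:
  assumes "x \<in> E" "e x \<in> points U"
  obtains v where "v \<in> U" "v \<in> V" "v \<noteq> 0" "v \<in> e x" "W v = w x" "W v \<noteq> 0"
proof -
  obtain v where v: "v \<in> U" "v \<noteq> 0" "e x = fvs.span {v}" using assms(2) by (rule pointsE)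
  have "v \<in> e x" using v(3) fvs.span_base by blast
  moreover have "v \<in> V" using Union_e(1)[of "{x}"] assms(1) calculation by auto
  ultimately show ?thesis
    using that v W_eq[OF assms(1)] weight_pos[OF assms(1)] by force
qed

text \<open>Translation invariance makes the zero set of \<open>W\<close> closed under addition. In
  a subspace one dimension larger, two vectors outside \<open>U\<close> agree up to a nonzero scalar
  modulo \<open>U\<close>, whence (ii). Condition (iii) holds because no hyperplane complement is
  lighter than the cogirth.\<close>

lemma equality_imp_extremal:
  assumes eq: "q * cogirth M w = (q - 1) * sum w E"
  shows "\<exists>k. extremal_structure k"
proof -
  define U where "U = {v \<in> V. W v = 0}"
  have UV: "U \<subseteq> V" by (auto simp: U_def)
  have finU: "finite U" by (rule finite_subset[OF UV finite_coord_space])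
  have subU: "fvs.subspace U"
  proof (rule fvs.subspaceI)
    show "0 \<in> U" by (simp add: U_def coord_space_zero W_eq_0_iff)
    then show "fscale c v \<in> U" if "v \<in> U" for c v
      using that by (cases "c = 0") (auto simp: U_def coord_space_closed W_scale)
    show "u + v \<in> U" if "u \<in> U" "v \<in> U" for u v
      using that translation_invariant[OF eq] by (auto simp: U_def coord_space_closed)
  qed
  have compl: "points V - e ` E = points U" unfolding U_def by (rule complement_eq)
  have "1 \<le> fvs.dim U"
  proof (rule ccontr)
    assume "\<not> 1 \<le> fvs.dim U"
    then have "card U = 1" using card_subspace[OF finU subU] by simp
    then obtain z where "U = {z}" by (rule card_1_singletonE)
    moreover obtain p where "p \<in> U" "p \<noteq> 0" using ex_missing_vector by (auto simp: U_def)
    ultimately show False using fvs.subspace_0[OF subU] by simp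
  qed
  moreover have "fvs.dim U < r"
  proof (rule ccontr)
    assume "\<not> fvs.dim U < r"
    then have "U = V"
      by (intro subspace_eqI_dim finite_coord_space subU subspace_coord_space UV) (simp add: dim_coord_space)
    \<comment> \<open>A nonzero form exists and every basis meets its complement, so
      \<open>M\<close> has an element and \<open>W\<close> cannot vanish on all of
      \<open>V\<close>.\<close>
    obtain a where "a \<in> V" "a \<noteq> 0" using ex_nonzero by blast
    then obtain x where "x \<in> E" using off_meets_basis ex_basis off_subset by blast
    then obtain v where "v \<in> V" "W v \<noteq> 0" by (rule point_vector[OF _ e_mem[OF \<open>x \<in> E\<close>]])
    then show False using \<open>U = V\<close> by (auto simp: U_def)
  qed
  moreover have "isomorphic (restriction (PG TYPE('f) r) (points V - e ` E)) (PG TYPE('f) (fvs.dim U))"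
    unfolding compl by (rule restriction_subspace_iso_PG[OF subU UV])
  moreover have "w x = w y"
    if P: "P \<subseteq> points V" "isomorphic (restriction (PG TYPE('f) r) P) (PG TYPE('f) (fvs.dim U + 1))"
      "points V - e ` E \<subseteq> P" and xy: "x \<in> E" "y \<in> E" "e x \<in> P" "e y \<in> P" for P x y
  proof -
    obtain U' where U': "fvs.subspace U'" "U' \<subseteq> V" "P = points U'" "fvs.dim U' = fvs.dim U + 1"
      using restriction_iso_PG_imp_subspace[OF P(1,2)] by blast
    obtain u where u: "u \<in> U'" "u \<in> V" "W u = w x" "W u \<noteq> 0"
      using xy(1,3) unfolding U'(3) by (rule point_vector)
    obtain v where v: "v \<in> U'" "v \<in> V" "W v = w y" "W v \<noteq> 0"
      using xy(2,4) unfolding U'(3) by (rule point_vector)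
    have UU': "U \<subseteq> U'"
    proof
      fix z assume z: "z \<in> U"
      show "z \<in> U'"
      proof (cases "z = 0")
        case False
        then have "fvs.span {z} \<in> points U'" using z P(3) compl U'(3) pointsI by blast
        then show ?thesis
          using span_mem_points_iff[OF subspace_imp_scale_closed[OF U'(1)] False] by simp
      qed (use fvs.subspace_0[OF U'(1)] in simp)
    qed
    have "u \<notin> fvs.span U" unfolding fvs.span_eq_iff[THEN iffD2, OF subU] using u(4) by (simp add: U_def)
    then have "fvs.dim (insert u U) = fvs.dim U'" using dim_insert_notin[OF finU] U'(4) by simp
    \<comment> \<open>\<open>U\<close> has codimension one in \<open>U'\<close>, so adding
      \<open>u\<close> fills it. The coefficient \<open>t\<close> obtained next is nonzero because
      \<open>v\<close> is not in \<open>U\<close>.\<close>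
    then have "fvs.span (insert u U) = U'"
      using UU' u(1) by (intro subspace_eqI_dim finite_subset[OF U'(2) finite_coord_space] U'(1)
          fvs.span_minimal) auto
    then obtain t where t: "v - fscale t u \<in> U"
      using v(1) fvs.span_breakdown_eq[of v u U] unfolding fvs.span_eq_iff[THEN iffD2, OF subU] by blast
    have "t \<noteq> 0" using t v(4) by (auto simp: U_def)
    have "W (fscale t u + (v - fscale t u)) = W (fscale t u)"
      using t u(2) by (intro translation_invariant[OF eq]) (auto simp: U_def coord_space_closed)
    then show ?thesis using u v W_scale[OF \<open>t \<noteq> 0\<close>] by simp
  qed
  moreover have "sum w N \<ge> (q - 1) * sum w (E - N)"
    if N: "N \<subseteq> E" "isomorphic (restriction M N) (AG TYPE('f) r)" for N
  proof -
    have "isomorphic (restriction (PG TYPE('f) r) (e ` N)) (AG TYPE('f) r)"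
      by (rule isomorphic_trans[OF isomorphic_sym[OF restriction_iso[OF N(1)]] N(2)])
    moreover have "e ` N \<subseteq> points V" using N(1) e_mem by blast
    moreover have "1 \<le> r" using \<open>fvs.dim U < r\<close> by simp
    \<comment> \<open>Containing the complement of a hyperplane suffices, since weights are
      positive.\<close>
    ultimately have "\<exists>a\<in>V. a \<noteq> 0 \<and> points {v \<in> V. dot r a v \<noteq> 0} \<subseteq> e ` N"
      by (intro restriction_iso_AG_imp_off_kernel)
    then obtain a where a: "a \<in> V" "a \<noteq> 0" "points {v \<in> V. dot r a v \<noteq> 0} \<subseteq> e ` N"
      by (elim bexE conjE)
    have "off a \<subseteq> N"
    proof
      fix x assume "x \<in> off a"
      then have "x \<in> E" "e x \<in> e ` N" using a(3) by (auto simp: off_def)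
      then show "x \<in> N" using e_inj N(1) by (auto dest: inj_onD)
    qed
    then have "cogirth M w \<le> sum w N"
      using cogirth_le_off[OF a(1,2)] sum_weight_mono N(1) by (meson order_trans)
    then have "q * cogirth M w \<le> q * sum w N" using q_ge_2 by simp
    moreover have "sum w E = sum w (E - N) + sum w N"
      by (rule sum.subset_diff[OF N(1) finite_ground])
    \<comment> \<open>With the total split along \<open>N\<close>, the claim reads
      \<open>(q - 1) * sum w E \<le> q * sum w N\<close>.\<close>
    ultimately show ?thesis using eq by (simp add: algebra_simps)
  qed
  ultimately show ?thesis unfolding extremal_structure_def by blast
qed

text \<open>Only a lower bound on the weights of complements is needed: some complement weighs at
  most the cogirth, and the opposite inequality is \<open>cogirth_bound\<close>.\<close>

lemma extremal_imp_equality: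
  assumes "extremal_structure k"
  shows "q * cogirth M w = (q - 1) * sum w E"
proof -
  have k: "1 \<le> k" "k < r"
    and iso: "isomorphic (restriction (PG TYPE('f) r) (points V - e ` E)) (PG TYPE('f) k)"
    and const: "\<And>P x y. P \<subseteq> points V \<Longrightarrow>
      isomorphic (restriction (PG TYPE('f) r) P) (PG TYPE('f) (k + 1)) \<Longrightarrow>
      points V - e ` E \<subseteq> P \<Longrightarrow> x \<in> E \<Longrightarrow> y \<in> E \<Longrightarrow> e x \<in> P \<Longrightarrow> e y \<in> P \<Longrightarrow> w x = w y"
    and affine: "\<And>N. N \<subseteq> E \<Longrightarrow> isomorphic (restriction M N) (AG TYPE('f) r) \<Longrightarrow>
      sum w N \<ge> (q - 1) * sum w (E - N)"
    using assms unfolding extremal_structure_def by blast+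
  obtain U where U: "fvs.subspace U" "U \<subseteq> V" "points V - e ` E = points U" "fvs.dim U = k"
    using restriction_iso_PG_imp_subspace[OF _ iso] by blast
  have finU: "finite U" by (rule finite_subset[OF U(2) finite_coord_space])
  have W0: "W v = 0 \<longleftrightarrow> v \<in> U" if v: "v \<in> V" for v
  proof (cases "v = 0")
    case True
    then show ?thesis using fvs.subspace_0[OF U(1)] by (simp add: W_eq_0_iff)
  next
    case False
    then have "v \<in> U \<longleftrightarrow> fvs.span {v} \<in> points V - e ` E"
      unfolding U(3) using span_mem_points_iff[OF subspace_imp_scale_closed[OF U(1)]] by blast
    then show ?thesis using W_eq_0_iff_span[OF False] v False pointsI by blast
  qed
  have inv: "W (v + p) = W v" if v: "v \<in> V" and p: "p \<in> U" for v p
  proof (cases "v \<in> U")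
    case True
    then have "v + p \<in> U" using p fvs.subspace_add[OF U(1)] by blast
    then show ?thesis using True v W0 U(2) by (metis subsetD)
  next
    case False
    have vp: "v + p \<in> V" using v p U(2) by (auto simp: coord_space_closed)
    have "v + p \<notin> U" using False fvs.subspace_diff[OF U(1) _ p, of "v + p"] by auto
    then have "W (v + p) \<noteq> 0" "W v \<noteq> 0" using False v vp W0 by auto
    then obtain x y where x: "x \<in> E" "v \<in> e x" and y: "y \<in> E" "v + p \<in> e y"
      and nz: "v \<noteq> 0" "v + p \<noteq> 0"
      unfolding W_eq_0_iff by blast
    \<comment> \<open>A subspace of dimension \<open>k + 1\<close> that contains all missing points
      together with both \<open>v\<close> and \<open>v + p\<close>, as (ii) requires.\<close>
    let ?U' = "fvs.span (insert v U)"
    have U'V: "?U' \<subseteq> V" using v U(2) by (intro fvs.span_minimal subspace_coord_space) auto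
    have "v \<notin> fvs.span U" unfolding fvs.span_eq_iff[THEN iffD2, OF U(1)] by (rule False)
    then have "fvs.dim ?U' = k + 1" using dim_insert_notin[OF finU] U(4) by simp
    then have "isomorphic (restriction (PG TYPE('f) r) (points ?U')) (PG TYPE('f) (k + 1))"
      using restriction_subspace_iso_PG[OF fvs.subspace_span U'V] by simp
    moreover have "points V - e ` E \<subseteq> points ?U'"
      unfolding U(3) by (intro points_mono) (auto intro: fvs.span_base)
    moreover have "e x \<in> points ?U'"
      using point_eq_span[OF e_mem[OF x(1)] x(2) nz(1)] nz(1) by (auto intro: pointsI fvs.span_base)
    moreover have "v + p \<in> ?U'" using p by (intro fvs.span_add fvs.span_base) auto
    then have "e y \<in> points ?U'"
      using point_eq_span[OF e_mem[OF y(1)] y(2) nz(2)] nz(2) by (auto intro: pointsI)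
    ultimately have "w x = w y" using const[OF points_mono[OF U'V]] x(1) y(1) by blast
    then show ?thesis using W_eq x y nz by simp
  qed
  have ge: "(q - 1) * sum w E \<le> q * sum w (off a)" if a: "a \<in> V" "a \<noteq> 0" for a
  proof (cases "\<forall>u\<in>U. dot r a u = 0")
    case True
    \<comment> \<open>All missing points lie on the hyperplane, so its full complement belongs to
      \<open>M\<close> and is a copy of \<open>AG\<close>.\<close>
    have img: "e ` off a = points {v \<in> V. dot r a v \<noteq> 0}"
    proof (intro equalityI subsetI)
      fix p assume p: "p \<in> points {v \<in> V. dot r a v \<noteq> 0}"
      then obtain v where v: "v \<in> V" "dot r a v \<noteq> 0" "v \<noteq> 0" "p = fvs.span {v}" by (auto elim: pointsE)
      then have "v \<notin> U" using True by blast
      then have "p \<in> e ` E" using W0[OF v(1)] W_eq_0_iff_span[OF v(3)] v(4) by blast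
      then show "p \<in> e ` off a" using p by (auto simp: off_def)
    qed (auto simp: off_def)
    have "isomorphic (restriction M (off a)) (AG TYPE('f) r)"
      using isomorphic_trans[OF restriction_iso[OF off_subset] ] restriction_off_kernel_iso_AG[OF a]
      unfolding img[symmetric] by blast
    then have "sum w (off a) \<ge> (q - 1) * sum w (E - off a)" by (rule affine[OF off_subset])
    moreover have "sum w E = sum w (E - off a) + sum w (off a)"
      by (rule sum.subset_diff[OF off_subset finite_ground])
    ultimately show ?thesis by (simp add: algebra_simps)
  next
    case False
    then obtain p where p: "p \<in> U" "dot r a p \<noteq> 0" by blast
    \<comment> \<open>Invariance under the multiples of \<open>p\<close> makes the excess of this
      hyperplane exactly zero.\<close>
    have "(\<Sum>v\<in>V. W v) = q * (\<Sum>v | v \<in> V \<and> dot r a v = 0. W v)"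
      using p U(2) inv fvs.subspace_scale[OF U(1) p(1)]
      by (intro sum_eq_card_times_kernel_sum[of p, folded q_eq]) auto
    then have "(q - 1) * ((q - 1) * sum w E - q * sum w (off a)) = 0"
      using hyperplane_excess[of a] by simp
    then show ?thesis using q_ge_2 by simp
  qed
  obtain a where a: "a \<in> V" "a \<noteq> 0" "sum w (off a) \<le> cogirth M w" using ex_off_le_cogirth by blast
  have "q * sum w (off a) \<le> q * cogirth M w" using a(3) q_ge_2 by simp
  then show ?thesis using ge[OF a(1,2)] cogirth_bound by simp
qed

lemma ratio_ge: "real_of_int (sum w E) / real_of_int (cogirth M w) \<ge> real_of_int q / (real_of_int q - 1)"
proof -
  have "real_of_int (q * cogirth M w) \<le> real_of_int ((q - 1) * sum w E)"
    using cogirth_bound by (simp only: of_int_le_iff)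
  then show ?thesis using cogirth_pos q_ge_2 by (simp add: field_simps)
qed

lemma ratio_eq_iff:
  "real_of_int (sum w E) / real_of_int (cogirth M w) = real_of_int q / (real_of_int q - 1) \<longleftrightarrow>
    q * cogirth M w = (q - 1) * sum w E"
proof -
  have "real_of_int (sum w E) / real_of_int (cogirth M w) = real_of_int q / (real_of_int q - 1) \<longleftrightarrow>
    real_of_int (q * cogirth M w) = real_of_int ((q - 1) * sum w E)"
    using cogirth_pos q_ge_2 by (auto simp: field_simps)
  then show ?thesis by (simp only: of_int_eq_iff)
qed

end

theorem theorem3p2:
  fixes q r :: nat and M :: "'a set_system" and w :: "'a \<Rightarrow> int"
  assumes "primepow q" and "card (UNIV :: 'f::{field,finite} set) = q"
    and "simple_matroid M" and "rank M = r" and "representable TYPE('f) M"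
    and "weight_function M w"
    and "\<not> isomorphic M (PG TYPE('f) r)"
  shows "real_of_int (sum w (ground M)) / real_of_int (cogirth M w) \<ge> real q / (real q - 1) \<and>
    (\<forall>e. matroid_embedding e M (PG TYPE('f) r) \<longrightarrow>
      (real_of_int (sum w (ground M)) / real_of_int (cogirth M w) = real q / (real q - 1) \<longleftrightarrow>
        (\<exists>k. 1 \<le> k \<and> k < r \<and>
          isomorphic (restriction (PG TYPE('f) r) (ground (PG TYPE('f) r) - e ` ground M))
            (PG TYPE('f) k) \<and>
          (\<forall>P\<subseteq>ground (PG TYPE('f) r).
            isomorphic (restriction (PG TYPE('f) r) P) (PG TYPE('f) (k + 1)) \<longrightarrow>
            ground (PG TYPE('f) r) - e ` ground M \<subseteq> P \<longrightarrow>
            (\<forall>x\<in>ground M. \<forall>y\<in>ground M. e x \<in> P \<longrightarrow> e y \<in> P \<longrightarrow> w x = w y)) \<and>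
          (\<forall>N\<subseteq>ground M. isomorphic (restriction M N) (AG TYPE('f) r) \<longrightarrow>
            sum w N \<ge> (int q - 1) * sum w (ground M - N)))))"
proof -
  have loc: "weighted_pg_restriction M e r w (int q)" if "matroid_embedding e M (PG TYPE('f) r)" for e
    using that assms
    by (auto simp: weighted_pg_restriction_def weighted_pg_restriction_axioms_def
        pg_restriction_def pg_restriction_axioms_def simple_matroid_def)
  \<comment> \<open>The inequality mentions no embedding, so one has to be produced for it.\<close>
  obtain e0 where "matroid_embedding e0 M (PG TYPE('f) r)"
    using representable_embedding[OF assms(3,5,4)] by blast
  note ge = weighted_pg_restriction.ratio_ge[OF loc[OF this], unfolded of_int_of_nat_eq]
  show ?thesis
  proof (intro conjI allI impI)
    fix e assume "matroid_embedding e M (PG TYPE('f) r)"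
    then interpret weighted_pg_restriction M e r w "int q" by (rule loc)
    have "int q * cogirth M w = (int q - 1) * sum w (ground M) \<longleftrightarrow> (\<exists>k. extremal_structure k)"
      using equality_imp_extremal extremal_imp_equality by blast
    from this[unfolded extremal_structure_def, folded ratio_eq_iff ground_PG, unfolded of_int_of_nat_eq]
    show "real_of_int (sum w (ground M)) / real_of_int (cogirth M w) = real q / (real q - 1) \<longleftrightarrow>
        (\<exists>k. 1 \<le> k \<and> k < r \<and>
          isomorphic (restriction (PG TYPE('f) r) (ground (PG TYPE('f) r) - e ` ground M))
            (PG TYPE('f) k) \<and>
          (\<forall>P\<subseteq>ground (PG TYPE('f) r).
            isomorphic (restriction (PG TYPE('f) r) P) (PG TYPE('f) (k + 1)) \<longrightarrow>
            ground (PG TYPE('f) r) - e ` ground M \<subseteq> P \<longrightarrow>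
            (\<forall>x\<in>ground M. \<forall>y\<in>ground M. e x \<in> P \<longrightarrow> e y \<in> P \<longrightarrow> w x = w y)) \<and>
          (\<forall>N\<subseteq>ground M. isomorphic (restriction M N) (AG TYPE('f) r) \<longrightarrow>
            sum w N \<ge> (int q - 1) * sum w (ground M - N)))" .
  qed (rule ge)
qed

end
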